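(* Let $\gamma^\dagger \in H^1_+(S^1)$. (i) Assume that $\gamma^\dagger \in W^{s,q}(S^1)$ with $1 < s \le 2$ and $2 \le q < +\infty$. Then there exist constants $c_1, c_2, c_3 > 0$ such that $$c_1 \|\gamma-\gamma^\dagger\|_{H^1_0}^2 \le \|\gamma\|_{H^1_0}^2 - \|\gamma^\dagger\|_{H^1_0}^2 + c_2 \|F(\gamma)-F(\gamma^\dagger)\|_{L^2}^{4-\frac{4}{s}} + c_3 \|F(\gamma)-F(\gamma^\dagger)\|_{L^2}^{2-\frac{2q}{qs-s+1}}$$ for every $\gamma \in H^1_+(S^1)$. (ii) Assume that $\gamma^\dagger \in W^{s,\infty}(S^1)$ with $1 < s \le 2$. Then there exist constants $c_1, c_2 > 0$ such that $$c_1 \|\gamma-\gamma^\dagger\|_{H^1_0}^2 \le \|\gamma\|_{H^1_0}^2 - \|\gamma^\dagger\|_{H^1_0}^2 + c_2 \|F(\gamma)-F(\gamma^\dagger)\|_{L^2}^{4-\frac{4}{s}}$$ for every $\gamma \in H^1_+(S^1)$.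
   Context: $S^1$ is the circle of length $2\pi$. $H^1(S^1)$ is the usual first order real-valued $L^2$-Sobolev space, whose elements are identified with their continuous representatives, and $H^1_+(S^1) := \{\gamma \in H^1(S^1) : \gamma(t) \ge 0 \text{ for every } t \in S^1\}$. The homogeneous first order Sobolev (semi)norm is $\|\gamma\|_{H^1_0} := \|\dot\gamma\|_{L^2(S^1)}$. For $\gamma \in H^1_+(S^1)$ the hypograph is $\operatorname{hyp}(\gamma) := \{(t,x) \in S^1\times\mathbb{R}_{\ge 0} : 0 \le x \le \gamma(t)\}$, and $F\colon H^1_+(S^1) \to L^2(S^1\times\mathbb{R}_{\ge 0})$ is the map $F(\gamma) := \chi_{\operatorname{hyp}(\gamma)}$, where $\chi_{\operatorname{hyp}(\gamma)}(t,x) = 1$ if $0\le x \le \gamma(t)$ and $=0$ if $x > \gamma(t)$. The norm $\|F(\gamma)-F(\gamma^\dagger)\|_{L^2}$ is that of $L^2(S^1\times\mathbb{R}_{\ge 0})$. $W^{s,q}(S^1)$, $s \in \mathbb{R}$, $1 \le q \le \infty$, denotes the (fractional order) Sobolev space in the sense of Bergh and Löfström, i.e. the space of distributions $f$ on $S^1$ such that the distribution with Fourier series $\sum_{k\in\mathbb{Z}} (1+k^2)^{s/2}\hat f(k) e^{ikt}$ belongs to $L^q(S^1)$. The constants may depend on $\gamma^\dagger$, $s$, $q$ but not on $\gamma$. *)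

theory Defs
  imports "HOL-Analysis.Analysis"
begin

text \<open>
  Functions on the circle of length \<open>2 \<pi>\<close> are represented by functions on the real line.
  Pointwise meaningful ones (test functions, continuous representatives) are required to be
  \<open>2 \<pi>\<close>-periodic; elements of \<open>L^q\<close> are only ever looked at on the fundamental
  domain \<open>[0, 2 \<pi>)\<close> carrying the measure \<open>circle\<close>.
\<close>

definition circle :: "real measure" where
  "circle = restrict_space lborel {0..<2 * pi}"

definition periodic :: "(real \<Rightarrow> 'a) \<Rightarrow> bool" where
  "periodic f \<longleftrightarrow> (\<forall>t. f (t + 2 * pi) = f t)"

definition Lq :: "'a measure \<Rightarrow> ereal \<Rightarrow> ('a \<Rightarrow> 'b::real_normed_vector) set" where
  "Lq M q = {f \<in> borel_measurable M.
     if q = \<infinity> then \<exists>C::real. AE x in M. norm (f x) \<le> C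
     else integrable M (\<lambda>x. norm (f x) powr real_of_ereal q)}"

definition L2_nrm :: "'a measure \<Rightarrow> ('a \<Rightarrow> 'b::real_normed_vector) \<Rightarrow> real" where
  "L2_nrm M f = sqrt (\<integral>x. (norm (f x))\<^sup>2 \<partial>M)"


definition vderiv :: "(real \<Rightarrow> complex) \<Rightarrow> real \<Rightarrow> complex" where
  "vderiv \<phi> = (\<lambda>t. vector_derivative \<phi> (at t))"

definition test_functions :: "(real \<Rightarrow> complex) set" where
  "test_functions = {\<phi>. periodic \<phi> \<and> (\<forall>n. (vderiv ^^ n) \<phi> differentiable_on UNIV)}"

text \<open>Only the values of a functional on \<open>test_functions\<close> matter. Continuity with respect to
  the topology of smooth functions is expressed by the usual seminorm estimate.\<close>

definition distributions :: "((real \<Rightarrow> complex) \<Rightarrow> complex) set" where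
  "distributions = {T.
     (\<forall>\<phi>\<in>test_functions. \<forall>\<psi>\<in>test_functions. T (\<lambda>t. \<phi> t + \<psi> t) = T \<phi> + T \<psi>) \<and>
     (\<forall>c. \<forall>\<phi>\<in>test_functions. T (\<lambda>t. c * \<phi> t) = c * T \<phi>) \<and>
     (\<exists>C N. \<forall>\<phi>\<in>test_functions.
        cmod (T \<phi>) \<le> C * (\<Sum>j\<le>(N::nat). SUP t. cmod ((vderiv ^^ j) \<phi> t)))}"

definition dist_of :: "(real \<Rightarrow> complex) \<Rightarrow> (real \<Rightarrow> complex) \<Rightarrow> complex" where
  "dist_of f \<phi> = (\<integral>t. f t * \<phi> t \<partial>circle)"

definition fourier_coeff :: "((real \<Rightarrow> complex) \<Rightarrow> complex) \<Rightarrow> int \<Rightarrow> complex" where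
  "fourier_coeff T k = T (\<lambda>t. cis (- (of_int k * t))) / of_real (2 * pi)"

text \<open>The distribution with Fourier series \<open>\<Sum>k. (1 + k^2)^(s/2) T^(k) e^(i k t)\<close> is the one
  having these Fourier coefficients (they determine it); it belongs to \<open>L^q\<close> if it is
  given by integration against some \<open>g\<close> in \<open>L^q\<close>.\<close>

definition sobolev_W :: "real \<Rightarrow> ereal \<Rightarrow> ((real \<Rightarrow> complex) \<Rightarrow> complex) set" where
  "sobolev_W s q = {T \<in> distributions. \<exists>g\<in>Lq circle q. \<forall>k.
     fourier_coeff (dist_of g) k
       = of_real ((1 + (of_int k)\<^sup>2) powr (s / 2)) * fourier_coeff T k}"


definition has_weak_deriv :: "(real \<Rightarrow> real) \<Rightarrow> (real \<Rightarrow> real) \<Rightarrow> bool" where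
  "has_weak_deriv \<gamma> g \<longleftrightarrow> (\<forall>\<phi>\<in>test_functions.
     dist_of (\<lambda>t. of_real (\<gamma> t)) (vderiv \<phi>) = - dist_of (\<lambda>t. of_real (g t)) \<phi>)"

text \<open>Elements are the continuous representatives.\<close>

definition H1 :: "(real \<Rightarrow> real) set" where
  "H1 = {\<gamma>. periodic \<gamma> \<and> continuous_on UNIV \<gamma> \<and> \<gamma> \<in> Lq circle 2 \<and>
     (\<exists>g\<in>Lq circle 2. has_weak_deriv \<gamma> g)}"

definition H1_plus :: "(real \<Rightarrow> real) set" where
  "H1_plus = {\<gamma> \<in> H1. \<forall>t. 0 \<le> \<gamma> t}"

text \<open>The weak derivative is unique up to null sets, so the choice does not affect the seminorm.\<close>

definition weak_deriv :: "(real \<Rightarrow> real) \<Rightarrow> real \<Rightarrow> real" where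
  "weak_deriv \<gamma> = (SOME g. g \<in> Lq circle 2 \<and> has_weak_deriv \<gamma> g)"

definition H10_nrm :: "(real \<Rightarrow> real) \<Rightarrow> real" where
  "H10_nrm \<gamma> = L2_nrm circle (weak_deriv \<gamma>)"


definition hyp :: "(real \<Rightarrow> real) \<Rightarrow> (real \<times> real) set" where
  "hyp \<gamma> = {(t, x). 0 \<le> x \<and> x \<le> \<gamma> t}"

definition F :: "(real \<Rightarrow> real) \<Rightarrow> real \<times> real \<Rightarrow> real" where
  "F \<gamma> = indicat_real (hyp \<gamma>)"

definition half_cylinder :: "(real \<times> real) measure" where
  "half_cylinder = circle \<Otimes>\<^sub>M restrict_space lborel {0..}"

definition F_dist :: "(real \<Rightarrow> real) \<Rightarrow> (real \<Rightarrow> real) \<Rightarrow> real" where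
  "F_dist \<gamma> \<eta> = L2_nrm half_cylinder (\<lambda>p. F \<gamma> p - F \<eta> p)"

end

theory Submission
  imports Defs
begin

text \<open>
  Put \<open>h = \<gamma> - \<gamma>d\<close>, \<open>D = \<gamma>d'\<close> and \<open>\<delta> = F_dist \<gamma> \<gamma>d\<close>; since both functions are nonnegative,
  \<open>\<delta>\<^sup>2\<close> is the \<open>L\<^sup>1\<close> norm of \<open>h\<close>.
  Expanding the square, everything reduces to absorbing the pairing of \<open>D\<close> with \<open>h'\<close>, which is split
  with the \<open>m\<close>-th Fejer mean \<open>\<sigma>\<close> of \<open>\<gamma>d\<close>:
  \<open>\<integral> D h' = \<integral> (D - \<sigma>') h' - \<integral> \<sigma>'' h\<close>.
  By Bessel's inequality and density of trigonometric polynomials the first part is at most a constant times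
  \<open>m powr (1 - s)\<close> times the norm of \<open>h'\<close>. The second part is at most
  \<open>(SUP t. \<bar>\<sigma>'' t\<bar>) * \<delta>\<^sup>2\<close>, where the supremum grows at most like \<open>m powr (5/2 - s)\<close> if
  \<open>\<gamma>d\<close> is in \<open>W\<^sup>s\<^sup>,\<^sup>2\<close>, by Cauchy-Schwarz, and like \<open>m powr (2 - s)\<close> if it is in \<open>W\<^sup>s\<^sup>,\<^sup>\<infinity>\<close>, because two
  summations by parts write the multiplier \<open>(1 + k\<^sup>2) powr (1 - s/2) * (1 - \<bar>k\<bar>/m)\<close> as a combination of
  (positive) Fejer kernels. Young's inequality with \<open>m\<close> about \<open>\<delta> powr (-1/s)\<close>, respectively
  \<open>\<delta> powr (-2/s)\<close>, finishes the proof for \<open>\<delta> < 1\<close>; for \<open>\<delta> \<ge> 1\<close> the trivial bound of the pairing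
  suffices. In case (i) the estimate for \<open>q = 2\<close> already gives a smaller error than the last term allows.
\<close>

section \<open>Square integrable functions\<close>

text \<open>The simplifier rewrites \<open>2 :: ereal\<close> to \<open>ereal 2\<close>, hence the second form.\<close>

lemma Lq_2_iff:
  "f \<in> Lq M 2 \<longleftrightarrow> f \<in> borel_measurable M \<and> integrable M (\<lambda>x. (norm (f x))\<^sup>2)"
  "f \<in> Lq M (ereal 2) \<longleftrightarrow> f \<in> borel_measurable M \<and> integrable M (\<lambda>x. (norm (f x))\<^sup>2)"
  by (simp_all add: Lq_def)

lemma Lq_measurable: "f \<in> Lq M q \<Longrightarrow> f \<in> borel_measurable M"
  by (simp add: Lq_def)

lemma L2_nrm_nonneg: "0 \<le> L2_nrm M f"
  by (simp add: L2_nrm_def)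

lemma L2_nrm_sq: "(L2_nrm M f)\<^sup>2 = (\<integral>x. (norm (f x))\<^sup>2 \<partial>M)"
  by (simp add: L2_nrm_def)

lemma of_real_Lq_2: "f \<in> Lq M 2 \<Longrightarrow> (\<lambda>x. complex_of_real (f x)) \<in> Lq M 2"
  by (auto simp: Lq_2_iff intro: borel_measurable_of_real)

lemma L2_nrm_of_real: "L2_nrm M (\<lambda>x. complex_of_real (f x)) = L2_nrm M f"
  by (simp add: L2_nrm_def)

lemma Lq_2_mult_integrable:
  fixes f g :: "'a \<Rightarrow> complex"
  assumes "f \<in> Lq M 2" "g \<in> Lq M 2"
  shows "integrable M (\<lambda>x. f x * g x)"
proof (rule Bochner_Integration.integrable_bound)
  show "integrable M (\<lambda>x. (norm (f x))\<^sup>2 + (norm (g x))\<^sup>2)"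
    using assms by (simp add: Lq_2_iff)
  show "(\<lambda>x. f x * g x) \<in> borel_measurable M"
    using assms[THEN Lq_measurable] by measurable
  have "norm (f x * g x) \<le> norm ((norm (f x))\<^sup>2 + (norm (g x))\<^sup>2)" for x
  proof -
    have "0 \<le> norm (f x) * norm (g x)" by simp
    then have "norm (f x) * norm (g x) \<le> (norm (f x))\<^sup>2 + (norm (g x))\<^sup>2"
      using sum_squares_bound[of "norm (f x)" "norm (g x)"] by linarith
    then show ?thesis by (simp add: norm_mult)
  qed
  then show "AE x in M. norm (f x * g x) \<le> norm ((norm (f x))\<^sup>2 + (norm (g x))\<^sup>2)"
    by simp
qed

text \<open>Bilinear, without a conjugate, because weak derivatives and Fourier coefficients are
  tested by bilinear pairings. It follows from the inequality for nonnegative extended integrals,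
  applied to the norms.\<close>

lemma L2_Cauchy_Schwarz:
  fixes f g :: "'a \<Rightarrow> complex"
  assumes f: "f \<in> Lq M 2" and g: "g \<in> Lq M 2"
  shows "norm (\<integral>x. f x * g x \<partial>M) \<le> L2_nrm M f * L2_nrm M g"
proof -
  let ?f = "\<lambda>x. norm (f x)" and ?g = "\<lambda>x. norm (g x)"
  have [measurable]: "f \<in> borel_measurable M" "g \<in> borel_measurable M"
    using f g by (auto simp: Lq_2_iff)
  have i: "integrable M (\<lambda>x. ?f x * ?g x)"
    using integrable_norm[OF Lq_2_mult_integrable[OF f g]] by (simp add: norm_mult)
  have e: "(\<integral>\<^sup>+x. ennreal (?f x) * ennreal (?g x) \<partial>M) = ennreal (\<integral>x. ?f x * ?g x \<partial>M)"
    using nn_integral_eq_integral[OF i] by (simp add: ennreal_mult)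
  have ef: "(\<integral>\<^sup>+x. (ennreal (?f x))\<^sup>2 \<partial>M) = ennreal ((L2_nrm M f)\<^sup>2)"
    using f nn_integral_eq_integral[of M "\<lambda>x. (?f x)\<^sup>2"] by (simp add: Lq_2_iff L2_nrm_sq ennreal_power)
  have eg: "(\<integral>\<^sup>+x. (ennreal (?g x))\<^sup>2 \<partial>M) = ennreal ((L2_nrm M g)\<^sup>2)"
    using g nn_integral_eq_integral[of M "\<lambda>x. (?g x)\<^sup>2"] by (simp add: Lq_2_iff L2_nrm_sq ennreal_power)
  have nn: "0 \<le> (\<integral>x. ?f x * ?g x \<partial>M)" by simp
  have "(ennreal (\<integral>x. ?f x * ?g x \<partial>M))\<^sup>2 \<le> ennreal ((L2_nrm M f)\<^sup>2) * ennreal ((L2_nrm M g)\<^sup>2)"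
    using Cauchy_Schwarz_nn_integral[of "\<lambda>x. ennreal (?f x)" M "\<lambda>x. ennreal (?g x)"]
    unfolding e ef eg by simp
  then have "ennreal ((\<integral>x. ?f x * ?g x \<partial>M)\<^sup>2) \<le> ennreal ((L2_nrm M f * L2_nrm M g)\<^sup>2)"
    using nn by (simp add: ennreal_power ennreal_mult power_mult_distrib)
  then have "(\<integral>x. ?f x * ?g x \<partial>M)\<^sup>2 \<le> (L2_nrm M f * L2_nrm M g)\<^sup>2"
    by (subst (asm) ennreal_le_iff) auto
  then have "(\<integral>x. ?f x * ?g x \<partial>M) \<le> L2_nrm M f * L2_nrm M g"
    by (rule power2_le_imp_le) (simp add: L2_nrm_nonneg)
  moreover have "norm (\<integral>x. f x * g x \<partial>M) \<le> (\<integral>x. norm (f x * g x) \<partial>M)"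
    by (rule integral_norm_bound)
  ultimately show ?thesis by (simp add: norm_mult)
qed

lemma Lq_2_add:
  fixes f g :: "'a \<Rightarrow> 'b::{real_normed_vector, second_countable_topology}"
  assumes "f \<in> Lq M 2" "g \<in> Lq M 2"
  shows "(\<lambda>x. f x + g x) \<in> Lq M 2"
proof -
  have "integrable M (\<lambda>x. (norm (f x + g x))\<^sup>2)"
  proof (rule Bochner_Integration.integrable_bound)
    show "integrable M (\<lambda>x. 2 * (norm (f x))\<^sup>2 + 2 * (norm (g x))\<^sup>2)"
      using assms by (simp add: Lq_2_iff)
    have "(norm (f x + g x))\<^sup>2 \<le> 2 * (norm (f x))\<^sup>2 + 2 * (norm (g x))\<^sup>2" for x
    proof -
      have "(norm (f x + g x))\<^sup>2 \<le> (norm (f x) + norm (g x))\<^sup>2"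
        by (intro power_mono norm_triangle_ineq) auto
      also have "\<dots> \<le> 2 * (norm (f x))\<^sup>2 + 2 * (norm (g x))\<^sup>2"
        using sum_squares_bound[of "norm (f x)" "norm (g x)"] by (simp add: power2_sum)
      finally show ?thesis .
    qed
    then show "AE x in M. norm ((norm (f x + g x))\<^sup>2) \<le> norm (2 * (norm (f x))\<^sup>2 + 2 * (norm (g x))\<^sup>2)"
      by simp
  qed (use assms[THEN Lq_measurable] in measurable)
  then show ?thesis using assms by (auto simp: Lq_2_iff intro: borel_measurable_add)
qed

lemma Lq_2_diff:
  fixes f g :: "'a \<Rightarrow> 'b::{real_normed_vector, second_countable_topology}"
  assumes "f \<in> Lq M 2" "g \<in> Lq M 2"
  shows "(\<lambda>x. f x - g x) \<in> Lq M 2"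
proof -
  have "(\<lambda>x. - g x) \<in> Lq M 2"
    using assms(2) borel_measurable_uminus[OF Lq_measurable[OF assms(2)]] unfolding Lq_2_iff by simp
  from Lq_2_add[OF assms(1) this] show ?thesis by simp
qed

text \<open>Expand the square and bound the cross term by Cauchy-Schwarz; conjugating
  \<open>g\<close> turns the bilinear pairing into the inner product.\<close>

lemma L2_nrm_triangle:
  fixes f g :: "'a \<Rightarrow> complex"
  assumes f: "f \<in> Lq M 2" and g: "g \<in> Lq M 2"
  shows "L2_nrm M (\<lambda>x. f x + g x) \<le> L2_nrm M f + L2_nrm M g"
proof -
  have cg: "(\<lambda>x. cnj (g x)) \<in> Lq M 2" "L2_nrm M (\<lambda>x. cnj (g x)) = L2_nrm M g"
  proof -
    have "(\<lambda>x. cnj (g x)) \<in> borel_measurable M"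
      by (rule measurable_compose[OF Lq_measurable[OF g]])
        (rule borel_measurable_continuous_onI[OF continuous_on_cnj[OF continuous_on_id]])
    then show "(\<lambda>x. cnj (g x)) \<in> Lq M 2" using g unfolding Lq_2_iff by simp
  qed (simp add: L2_nrm_def)
  define r where "r x = Re (f x * cnj (g x))" for x
  have r: "integrable M r" "(\<integral>x. r x \<partial>M) = Re (\<integral>x. f x * cnj (g x) \<partial>M)"
    unfolding r_def[abs_def]
    using integrable_Re[OF Lq_2_mult_integrable[OF f cg(1)]] integral_Re[OF Lq_2_mult_integrable[OF f cg(1)]]
    by blast+
  have "(L2_nrm M (\<lambda>x. f x + g x))\<^sup>2
      = (\<integral>x. (norm (f x))\<^sup>2 + (norm (g x))\<^sup>2 + 2 * r x \<partial>M)"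
    unfolding L2_nrm_sq
  proof (intro Bochner_Integration.integral_cong refl)
    show "(norm (f x + g x))\<^sup>2 = (norm (f x))\<^sup>2 + (norm (g x))\<^sup>2 + 2 * r x" for x
      unfolding r_def cmod_power2 by (simp add: power2_sum)
  qed
  also have "\<dots> = (L2_nrm M f)\<^sup>2 + (L2_nrm M g)\<^sup>2 + 2 * Re (\<integral>x. f x * cnj (g x) \<partial>M)"
  proof -
    have "integrable M (\<lambda>x. (norm (f x))\<^sup>2)" "integrable M (\<lambda>x. (norm (g x))\<^sup>2)"
      using f g by (auto simp: Lq_2_iff)
    then show ?thesis using r unfolding r(2) [symmetric] L2_nrm_sq by simp
  qed
  also have "\<dots> \<le> (L2_nrm M f)\<^sup>2 + (L2_nrm M g)\<^sup>2 + 2 * (L2_nrm M f * L2_nrm M g)"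
    using L2_Cauchy_Schwarz[OF f cg(1)] complex_Re_le_cmod[of "\<integral>x. f x * cnj (g x) \<partial>M"]
    by (simp add: cg(2))
  also have "\<dots> = (L2_nrm M f + L2_nrm M g)\<^sup>2"
    by (simp add: power2_sum)
  finally show ?thesis
    by (rule power2_le_imp_le) (simp add: L2_nrm_nonneg)
qed

lemma L2_nrm_cong_AE:
  assumes "AE x in M. f x = g x" "f \<in> borel_measurable M" "g \<in> borel_measurable M"
  shows "L2_nrm M f = L2_nrm M g"
  unfolding L2_nrm_def using assms by (intro arg_cong[where f=sqrt] integral_cong_AE) auto

lemma L2_nrm_eq_0_AE:
  assumes "f \<in> Lq M 2" "L2_nrm M f = 0" shows "AE x in M. f x = 0"
  using assms integral_nonneg_eq_0_iff_AE[of M "\<lambda>x. (norm (f x))\<^sup>2"]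
  by (simp add: Lq_2_iff L2_nrm_def)

lemma L2_nrm_minus_commute:
  "L2_nrm M (\<lambda>x. f x - g x) = L2_nrm M (\<lambda>x. g x - f x)"
  by (simp add: L2_nrm_def norm_minus_commute)

lemma (in finite_measure) Lq_2_integrable:
  fixes f :: "'a \<Rightarrow> complex"
  assumes "f \<in> Lq M 2" shows "integrable M f"
proof -
  have "(\<lambda>_. 1::complex) \<in> Lq M 2" by (simp add: Lq_2_iff)
  from Lq_2_mult_integrable[OF assms this] show ?thesis by simp
qed

lemma (in finite_measure) bounded_imp_Lq_2:
  assumes f: "f \<in> borel_measurable M" and B: "AE x in M. norm (f x) \<le> B"
  shows "f \<in> Lq M 2"
proof -
  have "AE x in M. norm ((norm (f x))\<^sup>2) \<le> B\<^sup>2"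
    using B by eventually_elim (simp add: power_mono)
  moreover have "(\<lambda>x. (norm (f x))\<^sup>2) \<in> borel_measurable M"
    using f by measurable
  ultimately have "integrable M (\<lambda>x. (norm (f x))\<^sup>2)"
    by (rule integrable_const_bound)
  then show ?thesis using f unfolding Lq_2_iff by simp
qed

text \<open>Pointwise \<open>a\<^sup>2 \<le> 1 + a powr q\<close>, and constants are integrable on a
  finite measure space. This reduces case (i) to square integrable data.\<close>

lemma (in finite_measure) Lq_imp_Lq_2:
  assumes "f \<in> Lq M (ereal q)" "2 \<le> q" shows "f \<in> Lq M 2"
proof -
  have "integrable M (\<lambda>x. (norm (f x))\<^sup>2)"
  proof (rule Bochner_Integration.integrable_bound)
    show "integrable M (\<lambda>x. 1 + norm (f x) powr q)"
      using assms by (simp add: Lq_def)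
    have "(norm (f x))\<^sup>2 \<le> 1 + norm (f x) powr q" for x
    proof (cases "norm (f x) \<le> 1")
      case True
      then have "(norm (f x))\<^sup>2 \<le> 1" by (simp add: power_le_one)
      then show ?thesis by (smt (verit) powr_ge_zero)
    next
      case False
      then have "norm (f x) powr 2 \<le> norm (f x) powr q"
        using assms by (intro powr_mono) auto
      then show ?thesis by simp
    qed
    then show "AE x in M. norm ((norm (f x))\<^sup>2) \<le> norm (1 + norm (f x) powr q)"
      by simp
  qed (use assms(1)[THEN Lq_measurable] in measurable)
  then show ?thesis using Lq_measurable[OF assms(1)] unfolding Lq_2_iff by simp
qed

lemma (in finite_measure) L2_nrm_le_bound:
  assumes "f \<in> borel_measurable M" "\<And>x. x \<in> space M \<Longrightarrow> norm (f x) \<le> B" "0 \<le> B"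
  shows "L2_nrm M f \<le> B * sqrt (measure M (space M))"
proof -
  have "(\<integral>x. (norm (f x))\<^sup>2 \<partial>M) \<le> (\<integral>x. B\<^sup>2 \<partial>M)"
  proof (rule integral_mono)
    show "integrable M (\<lambda>x. (norm (f x))\<^sup>2)"
      using bounded_imp_Lq_2[OF assms(1) AE_I2[OF assms(2)]] unfolding Lq_2_iff by simp
  qed (use assms in \<open>simp_all add: power_mono\<close>)
  also have "\<dots> = B\<^sup>2 * measure M (space M)" by simp
  finally have "sqrt (\<integral>x. (norm (f x))\<^sup>2 \<partial>M) \<le> sqrt (B\<^sup>2 * measure M (space M))" by simp
  then show ?thesis using assms(3) by (simp add: L2_nrm_def real_sqrt_mult)
qed

section \<open>Trigonometric polynomials on the circle\<close>

abbreviation chr :: "int \<Rightarrow> real \<Rightarrow> complex" where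
  "chr k t \<equiv> cis (of_int k * t)"

definition tpoly :: "int set \<Rightarrow> (int \<Rightarrow> complex) \<Rightarrow> real \<Rightarrow> complex" where
  "tpoly A a t = (\<Sum>k\<in>A. a k * chr k t)"

definition trig_polys :: "(real \<Rightarrow> complex) set" where
  "trig_polys = {tpoly A a | A a. finite A}"

lemma tpoly_in_trig_polys [intro]: "finite A \<Longrightarrow> tpoly A a \<in> trig_polys"
  by (auto simp: trig_polys_def)

lemma tpoly_superset:
  assumes "finite B" "A \<subseteq> B"
  shows "tpoly A a = tpoly B (\<lambda>k. if k \<in> A then a k else 0)"
  unfolding tpoly_def using assms
  by (intro ext sum.mono_neutral_cong_left) auto

lemma trig_polys_add:
  assumes "f \<in> trig_polys" "g \<in> trig_polys" shows "(\<lambda>t. f t + g t) \<in> trig_polys"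
proof -
  from assms obtain A a B b where f: "f = tpoly A a" "finite A" and g: "g = tpoly B b" "finite B"
    unfolding trig_polys_def by blast
  have "(\<lambda>t. f t + g t)
      = tpoly (A \<union> B) (\<lambda>k. (if k \<in> A then a k else 0) + (if k \<in> B then b k else 0))"
    unfolding f(1) g(1) tpoly_superset[of "A \<union> B" A a, OF finite_UnI[OF f(2) g(2)] Un_upper1]
      tpoly_superset[of "A \<union> B" B b, OF finite_UnI[OF f(2) g(2)] Un_upper2]
    by (simp add: tpoly_def sum.distrib distrib_right fun_eq_iff)
  then show ?thesis using f g by auto
qed

lemma trig_polys_chr: "(\<lambda>t. c * chr k t) \<in> trig_polys"
  using tpoly_in_trig_polys[of "{k}" "\<lambda>_. c"] by (simp add: tpoly_def[abs_def])

lemma trig_polys_const: "(\<lambda>t. c) \<in> trig_polys"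
  using trig_polys_chr[of c 0] by simp

lemma trig_polys_sum:
  assumes "\<And>i. i \<in> I \<Longrightarrow> f i \<in> trig_polys" shows "(\<lambda>t. \<Sum>i\<in>I. f i t) \<in> trig_polys"
  using assms by (induction I rule: infinite_finite_induct) (auto intro: trig_polys_const trig_polys_add)

lemma trig_polys_mult:
  assumes "f \<in> trig_polys" "g \<in> trig_polys" shows "(\<lambda>t. f t * g t) \<in> trig_polys"
proof -
  from assms obtain A a B b where f: "f = tpoly A a" and g: "g = tpoly B b"
    unfolding trig_polys_def by blast
  have "(\<lambda>t. f t * g t) = (\<lambda>t. \<Sum>i\<in>A. \<Sum>j\<in>B. (a i * b j) * chr (i + j) t)"
    unfolding f g tpoly_def
    by (simp add: sum_product fun_eq_iff distrib_right cis_mult[symmetric] mult.assoc mult.left_commute)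
  also have "\<dots> \<in> trig_polys"
    by (intro trig_polys_sum trig_polys_chr)
  finally show ?thesis .
qed

lemma chr_has_vector_derivative:
  "((\<lambda>t. c * chr k t) has_vector_derivative \<i> * of_int k * c * chr k t) (at t)"
proof -
  have "((\<lambda>x. c * exp (\<i> * (of_int k * x))) has_field_derivative
      c * (exp (\<i> * (of_int k * of_real t)) * (\<i> * of_int k))) (at (complex_of_real t))"
    by (auto intro!: derivative_eq_intros)
  from has_vector_derivative_real_field[OF this] show ?thesis
    by (simp add: cis_conv_exp mult_ac)
qed

lemma tpoly_has_vector_derivative:
  "(tpoly A a has_vector_derivative tpoly A (\<lambda>k. \<i> * of_int k * a k) t) (at t)"
  unfolding tpoly_def[abs_def] by (intro has_vector_derivative_sum chr_has_vector_derivative)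

lemma vderiv_tpoly: "vderiv (tpoly A a) = tpoly A (\<lambda>k. \<i> * of_int k * a k)"
  unfolding vderiv_def
  by (intro ext vector_derivative_at tpoly_has_vector_derivative)

lemma vderiv_pow_tpoly: "\<exists>b. (vderiv ^^ n) (tpoly A a) = tpoly A b"
  by (induction n) (auto simp: vderiv_tpoly intro: exI[of _ a])

lemma periodic_tpoly: "periodic (tpoly A a)"
  unfolding periodic_def tpoly_def
proof (intro allI sum.cong refl)
  fix t k
  have "cis (2 * pi * of_int k) = 1" by (rule cis_multiple_2pi) simp
  then have "chr k (t + 2 * pi) = chr k t"
    unfolding distrib_left cis_mult [symmetric] by (simp add: mult_ac)
  then show "a k * chr k (t + 2 * pi) = a k * chr k t" by simp
qed

lemma trig_polys_test: "p \<in> trig_polys \<Longrightarrow> p \<in> test_functions"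
proof -
  assume "p \<in> trig_polys"
  then obtain A a where p: "p = tpoly A a" by (auto simp: trig_polys_def)
  have "(vderiv ^^ n) p differentiable_on UNIV" for n
    using vderiv_pow_tpoly[of n A a] tpoly_has_vector_derivative
    unfolding p differentiable_on_def
    by (metis UNIV_I differentiableI_vector)
  then show ?thesis by (simp add: test_functions_def p periodic_tpoly)
qed

section \<open>The circle as a finite measure space, and Fourier coefficients\<close>

interpretation circle: finite_measure circle
  unfolding circle_def
  by (intro finite_measure_restrict_space finite_measureI) (auto simp: emeasure_restrict_space)

lemma space_circle [simp]: "space circle = {0..<2 * pi}"
  by (simp add: circle_def space_restrict_space)

lemma measure_circle [simp]: "measure circle {0..<2 * pi} = 2 * pi"
  by (simp add: circle_def measure_restrict_space)

lemma circle_measurable: "f \<in> borel_measurable borel \<Longrightarrow> f \<in> borel_measurable circle"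
  unfolding circle_def by (intro measurable_restrict_space1) simp

lemma circle_continuous: "continuous_on UNIV f \<Longrightarrow> f \<in> borel_measurable circle"
  by (intro circle_measurable borel_measurable_continuous_onI)

lemma continuous_on_tpoly: "continuous_on UNIV (tpoly A a)"
  using tpoly_has_vector_derivative
  by (meson continuous_at_imp_continuous_on has_vector_derivative_continuous)

lemma tpoly_norm_le: "norm (tpoly A a t) \<le> (\<Sum>k\<in>A. norm (a k))"
  unfolding tpoly_def by (rule order_trans[OF norm_sum]) (simp add: norm_mult)

lemma trig_polys_Lq_2: "p \<in> trig_polys \<Longrightarrow> p \<in> Lq circle 2"
proof -
  assume "p \<in> trig_polys"
  then obtain A a where p: "p = tpoly A a" by (auto simp: trig_polys_def)
  show ?thesis
    unfolding p by (rule circle.bounded_imp_Lq_2[OF circle_continuous[OF continuous_on_tpoly] AE_I2[OF tpoly_norm_le]])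
qed

lemma chr_Lq_2: "chr k \<in> Lq circle 2"
  using trig_polys_Lq_2[OF trig_polys_chr[of 1 k]] by simp

lemma integral_chr: "(\<integral>t. chr k t \<partial>circle) = (if k = 0 then 2 * pi else 0)"
proof (cases "k = 0")
  case False
  have 1: "(\<integral>t. chr k t \<partial>circle) = (LINT t:{0..<2*pi}|lborel. chr k t)"
    unfolding circle_def set_lebesgue_integral_def by (simp add: integral_restrict_space)
  \<comment> \<open>Adding the null endpoint \<open>2 * pi\<close> gives the compact interval on
    which the fundamental theorem of calculus is applied.\<close>
  also have "\<dots> = (LINT t:{0..2*pi}|lborel. chr k t)"
  proof (rule set_integral_cong_set)
    show "AE x in lborel. (x \<in> {0..2*pi}) = (x \<in> {0..<2*pi})"
      using AE_lborel_singleton[of "2*pi"] by eventually_elim auto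
    have [measurable]: "chr k \<in> borel_measurable borel"
      by (intro borel_measurable_continuous_onI continuous_intros)
    show "set_borel_measurable lborel {0..2*pi} (chr k)" "set_borel_measurable lborel {0..<2*pi} (chr k)"
      unfolding set_borel_measurable_def by measurable
  qed
  also have "\<dots> = chr k (2*pi) / (\<i> * of_int k) - chr k 0 / (\<i> * of_int k)"
  proof (unfold set_lebesgue_integral_def, rule integral_FTC_atLeastAtMost)
    fix x :: real
    show "((\<lambda>t. chr k t / (\<i> * of_int k)) has_vector_derivative chr k x) (at x within {0..2*pi})"
      using chr_has_vector_derivative[of "1 / (\<i> * of_int k)" k x] False
      by (auto intro: has_vector_derivative_at_within)
  qed (auto intro!: continuous_intros)
  also have "chr k (2*pi) = 1"
    using cis_multiple_2pi[of "of_int k"] by (simp add: mult_ac)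
  finally show ?thesis using False by simp
qed (simp add: scaleR_conv_of_real)

lemma circle_integrable_chr: "integrable circle (\<lambda>t. chr k t)"
  using circle.Lq_2_integrable[OF chr_Lq_2] .

definition fc :: "(real \<Rightarrow> complex) \<Rightarrow> int \<Rightarrow> complex" where
  "fc f k = (\<integral>t. f t * chr (- k) t \<partial>circle) / (2 * pi)"

lemma fourier_coeff_dist_of: "fourier_coeff (dist_of f) k = fc f k"
  by (simp add: fourier_coeff_def dist_of_def fc_def)

text \<open>The pairing carries no conjugate, so frequency \<open>k\<close> of the polynomial meets
  frequency \<open>- k\<close> of \<open>f\<close>.\<close>

lemma integral_mult_tpoly:
  assumes "f \<in> Lq circle 2"
  shows "(\<integral>t. f t * tpoly A a t \<partial>circle) = 2 * pi * (\<Sum>k\<in>A. fc f (- k) * a k)"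
proof -
  have "(\<integral>t. f t * tpoly A a t \<partial>circle) = (\<integral>t. (\<Sum>k\<in>A. a k * (f t * chr k t)) \<partial>circle)"
    by (simp add: tpoly_def sum_distrib_left mult_ac)
  also have "\<dots> = (\<Sum>k\<in>A. \<integral>t. a k * (f t * chr k t) \<partial>circle)"
    by (intro Bochner_Integration.integral_sum integrable_mult_right Lq_2_mult_integrable assms chr_Lq_2)
  also have "\<dots> = 2 * pi * (\<Sum>k\<in>A. fc f (- k) * a k)"
    by (simp add: fc_def sum_distrib_left mult_ac)
  finally show ?thesis .
qed

lemma fc_tpoly:
  assumes "finite A" shows "fc (tpoly A a) k = (if k \<in> A then a k else 0)"
proof -
  have "(\<integral>t. tpoly A a t * chr (- k) t \<partial>circle)
      = (\<integral>t. (\<Sum>j\<in>A. a j * chr (j - k) t) \<partial>circle)"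
    by (simp add: tpoly_def sum_distrib_right mult.assoc cis_mult) (simp add: algebra_simps)
  also have "\<dots> = (\<Sum>j\<in>A. \<integral>t. a j * chr (j - k) t \<partial>circle)"
    by (intro Bochner_Integration.integral_sum integrable_mult_right circle_integrable_chr)
  also have "\<dots> = (\<Sum>j\<in>A. a j * (if j = k then 2 * pi else 0))"
    by (intro sum.cong refl) (simp only: integral_mult_right_zero integral_chr right_minus_eq)
  also have "\<dots> = (\<Sum>j\<in>A. if j = k then 2 * pi * a k else 0)"
    by (intro sum.cong refl) auto
  also have "\<dots> = (if k \<in> A then 2 * pi * a k else 0)"
    using assms by (simp add: sum.delta)
  finally show ?thesis by (auto simp: fc_def)
qed

lemma cnj_tpoly: "cnj (tpoly A a t) = tpoly (uminus ` A) (\<lambda>k. cnj (a (- k))) t"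
  unfolding tpoly_def by (subst sum.reindex) (auto simp: cis_cnj)

lemma tpoly_L2_nrm:
  assumes "finite A" shows "(L2_nrm circle (tpoly A a))\<^sup>2 = 2 * pi * (\<Sum>k\<in>A. (norm (a k))\<^sup>2)"
proof -
  have "complex_of_real ((L2_nrm circle (tpoly A a))\<^sup>2)
      = (\<integral>t. tpoly A a t * tpoly (uminus ` A) (\<lambda>k. cnj (a (- k))) t \<partial>circle)"
    unfolding L2_nrm_sq cnj_tpoly [symmetric] complex_norm_square [symmetric] by (rule integral_complex_of_real[symmetric])
  also have "\<dots> = 2 * pi * (\<Sum>k\<in>uminus ` A. fc (tpoly A a) (- k) * cnj (a (- k)))"
    using assms by (intro integral_mult_tpoly trig_polys_Lq_2) auto
  also have "\<dots> = 2 * pi * (\<Sum>k\<in>A. a k * cnj (a k))"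
    using assms by (subst sum.reindex) (auto simp: fc_tpoly)
  also have "\<dots> = complex_of_real (2 * pi * (\<Sum>k\<in>A. (norm (a k))\<^sup>2))"
    by (simp add: complex_norm_square[symmetric] flip: of_real_power)
  finally show ?thesis by (simp only: of_real_eq_iff)
qed

section \<open>Bessel's inequality and bounds by Fourier coefficients\<close>

text \<open>Test \<open>f\<close> against the conjugate \<open>?p\<close> of its partial Fourier
  sum: the pairing equals \<open>?S\<close>, and so does the squared norm of \<open>?p\<close>.
  Cauchy-Schwarz then gives the claim after one factor \<open>?S\<close> is cancelled.\<close>

lemma Bessel:
  assumes f: "f \<in> Lq circle 2" and A: "finite A"
  shows "2 * pi * (\<Sum>k\<in>A. (norm (fc f k))\<^sup>2) \<le> (L2_nrm circle f)\<^sup>2"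
proof -
  let ?p = "tpoly (uminus ` A) (\<lambda>k. cnj (fc f (- k)))"
  let ?S = "2 * pi * (\<Sum>k\<in>A. (norm (fc f k))\<^sup>2)"
  have S0: "0 \<le> ?S" by (intro mult_nonneg_nonneg sum_nonneg) auto
  have p: "(L2_nrm circle ?p)\<^sup>2 = ?S"
    using A by (subst tpoly_L2_nrm) (auto simp: sum.reindex)
  have "(\<integral>t. f t * ?p t \<partial>circle) = 2 * pi * (\<Sum>k\<in>A. fc f k * cnj (fc f k))"
    using f by (subst integral_mult_tpoly) (auto simp: sum.reindex)
  also have "\<dots> = complex_of_real ?S"
    by (simp add: complex_norm_square[symmetric] flip: of_real_power)
  finally have "norm (\<integral>t. f t * ?p t \<partial>circle) = ?S"
    using S0 by (metis norm_of_real abs_of_nonneg)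
  then have "?S \<le> L2_nrm circle f * L2_nrm circle ?p"
    using L2_Cauchy_Schwarz[OF f trig_polys_Lq_2[OF tpoly_in_trig_polys], of "uminus ` A" "\<lambda>k. cnj (fc f (- k))"] A
    by simp
  then have "?S\<^sup>2 \<le> (L2_nrm circle f)\<^sup>2 * ?S"
    unfolding p [symmetric] power_mult_distrib [symmetric]
    using S0 by (intro power_mono) (auto simp: p)
  then have "?S * ?S \<le> (L2_nrm circle f)\<^sup>2 * ?S" by (simp only: power2_eq_square)
  \<comment> \<open>Cancelling requires \<open>?S\<close> to be positive; if it vanishes, the claim
    only says that a square is nonnegative.\<close>
  then show ?thesis using S0 mult_right_le_imp_le[of ?S ?S "(L2_nrm circle f)\<^sup>2"]
    by (metis order.order_iff_strict zero_le_power2)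
qed

text \<open>A trigonometric polynomial makes the pairing a finite sum, so \<open>f\<close> enters
  only through its coefficients, and Cauchy-Schwarz for sums with Bessel's inequality for
  \<open>g\<close> suffices. \<open>L2_pairing_le\<close> replaces \<open>p\<close> by a square
  integrable real function.\<close>

lemma L2_pairing_trig_poly_le:
  assumes f: "f \<in> Lq circle 2" and g: "g \<in> Lq circle 2" and p: "p \<in> trig_polys" and "0 \<le> C"
    and bd: "\<And>k. norm (fc f k) \<le> C * norm (fc g k)"
  shows "norm (\<integral>t. f t * p t \<partial>circle) \<le> C * L2_nrm circle g * L2_nrm circle p"
proof -
  obtain A b where p: "p = tpoly A b" and A: "finite A" using p by (auto simp: trig_polys_def)
  have "norm (\<Sum>k\<in>A. fc f (- k) * b k) \<le> (\<Sum>k\<in>A. C * (norm (fc g (- k)) * norm (b k)))"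
    by (rule order_trans[OF norm_sum])
      (auto intro!: sum_mono mult_right_mono simp: norm_mult mult.assoc [symmetric] bd)
  also have "\<dots> = C * (\<Sum>k\<in>A. norm (fc g (- k)) * norm (b k))"
    by (simp add: sum_distrib_left)
  finally have "norm (\<integral>t. f t * p t \<partial>circle) \<le> C * (2 * pi * (\<Sum>k\<in>A. norm (fc g (- k)) * norm (b k)))"
    unfolding p integral_mult_tpoly[OF f] by (simp add: norm_mult mult_ac mult_left_mono)
  also have "\<dots> \<le> C * (L2_nrm circle g * L2_nrm circle p)"
  proof (intro mult_left_mono)
    have "(2 * pi * (\<Sum>k\<in>A. norm (fc g (- k)) * norm (b k)))\<^sup>2
        \<le> (2 * pi)\<^sup>2 * ((\<Sum>k\<in>A. (norm (fc g (- k)))\<^sup>2) * (\<Sum>k\<in>A. (norm (b k))\<^sup>2))"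
      unfolding power_mult_distrib[of "2 * pi"]
      by (intro mult_left_mono Cauchy_Schwarz_ineq_sum) auto
    also have "\<dots> = (2 * pi * (\<Sum>k\<in>A. (norm (fc g (- k)))\<^sup>2)) * (L2_nrm circle p)\<^sup>2"
      unfolding p tpoly_L2_nrm[OF A] by (simp add: power2_eq_square)
    also have "(\<Sum>k\<in>A. (norm (fc g (- k)))\<^sup>2) = (\<Sum>k\<in>uminus ` A. (norm (fc g k))\<^sup>2)"
      by (simp add: sum.reindex)
    also have "(2 * pi * (\<Sum>k\<in>uminus ` A. (norm (fc g k))\<^sup>2)) * (L2_nrm circle p)\<^sup>2
        \<le> (L2_nrm circle g)\<^sup>2 * (L2_nrm circle p)\<^sup>2"
      using A by (intro mult_right_mono Bessel[OF g]) auto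
    finally show "2 * pi * (\<Sum>k\<in>A. norm (fc g (- k)) * norm (b k)) \<le> L2_nrm circle g * L2_nrm circle p"
      unfolding power_mult_distrib [symmetric]
      by (rule power2_le_imp_le) (simp add: L2_nrm_nonneg)
  qed fact
  finally show ?thesis by (simp add: mult.assoc)
qed

section \<open>Fejer sums as multipliers\<close>

text \<open>For \<open>a k = fc f k * chr k t\<close> this is the Dirichlet partial sum of the
  Fourier series of \<open>f\<close> at \<open>t\<close>.\<close>

definition sym_sum :: "(int \<Rightarrow> complex) \<Rightarrow> nat \<Rightarrow> complex" where
  "sym_sum a n = (\<Sum>k\<in>{- int n..int n}. a k)"

text \<open>For \<open>a k = fc f k * chr k t\<close> this is \<open>n + 1\<close> times the Fejer mean of \<open>f\<close> of order \<open>n\<close> at \<open>t\<close>.\<close>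

definition fejer_sum :: "(int \<Rightarrow> complex) \<Rightarrow> nat \<Rightarrow> complex" where
  "fejer_sum a n = (\<Sum>i\<in>{0..int n}. \<Sum>j\<in>{0..int n}. a (j - i))"

lemma sum_sym_Suc:
  fixes a :: "int \<Rightarrow> complex"
  shows "(\<Sum>k\<in>{- int (Suc n)..int (Suc n)}. a k)
    = (\<Sum>k\<in>{- int n..int n}. a k) + a (int (Suc n)) + a (- int (Suc n))"
proof -
  have "{- int (Suc n)..int (Suc n)} = insert (int (Suc n)) (insert (- int (Suc n)) {- int n..int n})"
    by auto
  then show ?thesis by (simp add: add_ac)
qed

text \<open>Enlarging the square of index pairs by one row and one column adds each of the
  differences \<open>1..n + 1\<close> and \<open>- (n + 1)..- 1\<close> once, and \<open>0\<close>
  once at the corner.\<close>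

lemma fejer_sum_Suc: "fejer_sum a (Suc n) = fejer_sum a n + sym_sum a (Suc n)"
proof -
  let ?I = "{0..int n}" and ?m = "int n + 1"
  have ins: "{0..int (Suc n)} = insert ?m ?I" by auto
  have "fejer_sum a (Suc n) = fejer_sum a n + (\<Sum>i\<in>?I. a (?m - i)) + ((\<Sum>j\<in>?I. a (j - ?m)) + a 0)"
    unfolding fejer_sum_def ins by (simp add: sum.distrib add_ac)
  moreover have "(\<Sum>i\<in>?I. a (?m - i)) = (\<Sum>k\<in>{1..?m}. a k)"
    by (rule sum.reindex_bij_witness[of _ "\<lambda>k. ?m - k" "\<lambda>k. ?m - k"]) auto
  moreover have "(\<Sum>j\<in>?I. a (j - ?m)) = (\<Sum>k\<in>{-?m..-1}. a k)"
    by (rule sum.reindex_bij_witness[of _ "\<lambda>k. k + ?m" "\<lambda>k. k - ?m"]) auto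
  moreover have "sym_sum a (Suc n) = (\<Sum>k\<in>{-?m..-1}. a k) + (a 0 + (\<Sum>k\<in>{1..?m}. a k))"
  proof -
    have "{- int (Suc n)..int (Suc n)} = {-?m..-1} \<union> insert 0 {1..?m}" by auto
    then show ?thesis unfolding sym_sum_def by (simp add: sum.union_disjoint)
  qed
  ultimately show ?thesis by (simp add: add_ac)
qed

text \<open>\<open>fejer_sum\<close> accumulates \<open>sym_sum\<close>, which accumulates the pairs
  \<open>a k + a (- k)\<close>. Two summations by parts therefore move two differences onto
  \<open>M\<close> and leave two boundary terms at \<open>N\<close>.\<close>

lemma second_summation_by_parts:
  fixes M :: "nat \<Rightarrow> real"
  shows "(\<Sum>n\<le>N. of_real (M n - 2 * M (n + 1) + M (n + 2)) * fejer_sum a n)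
    = (\<Sum>k\<in>{- int N..int N}. of_real (M (nat \<bar>k\<bar>)) * a k)
      - of_real (M (N + 1)) * sym_sum a N - of_real (M (N + 1) - M (N + 2)) * fejer_sum a N"
proof (induction N)
  case 0
  show ?case by (simp add: fejer_sum_def sym_sum_def algebra_simps)
next
  case (Suc N)
  have D: "sym_sum a (Suc N) = sym_sum a N + a (int (Suc N)) + a (- int (Suc N))"
    unfolding sym_sum_def by (rule sum_sym_Suc)
  have *: "nat \<bar>int (Suc N)\<bar> = Suc N" "nat \<bar>- int (Suc N)\<bar> = Suc N" by simp_all
  show ?case
    unfolding sum.atMost_Suc Suc.IH fejer_sum_Suc sum_sym_Suc * D
    by (simp add: algebra_simps)
qed

section \<open>Multiplier bounds from the positive Fejer kernel\<close>

text \<open>Up to the factor \<open>2 * pi\<close>, the Fejer sum at \<open>t\<close> is the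
  integral of \<open>g\<close> against the nonnegative kernel \<open>(norm (q u))\<^sup>2\<close>,
  whose total mass is \<open>2 * pi * (n + 1)\<close>. Positivity thus passes the essential bound of
  \<open>g\<close> on without a logarithmic loss.\<close>

lemma fejer_sum_fc_bound:
  assumes g: "g \<in> borel_measurable circle" and B: "AE t in circle. norm (g t) \<le> B"
  shows "norm (fejer_sum (\<lambda>k. fc g k * chr k t) n) \<le> B * (real n + 1)"
proof -
  let ?I = "{0..int n}"
  \<comment> \<open>The phases depending on \<open>t\<close> centre the kernel
    \<open>(norm (q u))\<^sup>2\<close> at \<open>u = t\<close>.\<close>
  define q where "q = tpoly ?I (\<lambda>k. chr (- k) t)"
  have g2: "g \<in> Lq circle 2" by (rule circle.bounded_imp_Lq_2[OF g B])
  have q2: "q \<in> Lq circle 2" unfolding q_def by (intro trig_polys_Lq_2) auto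
  have nq: "(L2_nrm circle q)\<^sup>2 = 2 * pi * (real n + 1)"
    unfolding q_def by (subst tpoly_L2_nrm) auto
  have qq: "complex_of_real ((norm (q u))\<^sup>2) = (\<Sum>i\<in>?I. \<Sum>j\<in>?I. chr (j - i) t * chr (- (j - i)) u)" for u
  proof -
    have "complex_of_real ((norm (q u))\<^sup>2) = q u * cnj (q u)" by (rule complex_norm_square)
    also have "\<dots> = (\<Sum>i\<in>?I. \<Sum>j\<in>?I. (chr (- i) t * chr i u) * (chr j t * chr (- j) u))"
      unfolding q_def tpoly_def sum_product[symmetric] by (simp add: cis_cnj)
    also have "\<dots> = (\<Sum>i\<in>?I. \<Sum>j\<in>?I. chr (j - i) t * chr (- (j - i)) u)"
      by (intro sum.cong refl) (simp add: cis_mult algebra_simps)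
    finally show ?thesis .
  qed
  have "(\<integral>u. g u * complex_of_real ((norm (q u))\<^sup>2) \<partial>circle)
      = (\<integral>u. (\<Sum>i\<in>?I. \<Sum>j\<in>?I. chr (j - i) t * (g u * chr (- (j - i)) u)) \<partial>circle)"
    unfolding qq by (simp add: sum_distrib_left mult_ac)
  also have "\<dots> = (\<Sum>i\<in>?I. \<Sum>j\<in>?I. \<integral>u. chr (j - i) t * (g u * chr (- (j - i)) u) \<partial>circle)"
    by (subst Bochner_Integration.integral_sum,
        intro Bochner_Integration.integrable_sum integrable_mult_right Lq_2_mult_integrable g2 chr_Lq_2,
        intro sum.cong refl Bochner_Integration.integral_sum integrable_mult_right
          Lq_2_mult_integrable g2 chr_Lq_2)
  also have "\<dots> = 2 * pi * fejer_sum (\<lambda>k. fc g k * chr k t) n"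
  proof -
    have "(\<integral>u. g u * chr (- k) u \<partial>circle) = 2 * pi * fc g k" for k by (simp add: fc_def)
    then show ?thesis
      unfolding fejer_sum_def sum_distrib_left integral_mult_right_zero by (simp only: mult_ac)
  qed
  finally have eq: "2 * pi * fejer_sum (\<lambda>k. fc g k * chr k t) n
    = (\<integral>u. g u * complex_of_real ((norm (q u))\<^sup>2) \<partial>circle)" ..
  have qi: "integrable circle (\<lambda>u. (norm (q u))\<^sup>2)" using q2 by (simp add: Lq_2_iff)
  have "norm (\<integral>u. g u * complex_of_real ((norm (q u))\<^sup>2) \<partial>circle)
      \<le> (\<integral>u. norm (g u * complex_of_real ((norm (q u))\<^sup>2)) \<partial>circle)"
    by (rule integral_norm_bound)
  also have "\<dots> \<le> (\<integral>u. B * (norm (q u))\<^sup>2 \<partial>circle)"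
  proof (rule integral_mono_AE)
    have bd: "AE u in circle. norm (g u * complex_of_real ((norm (q u))\<^sup>2)) \<le> B * (norm (q u))\<^sup>2"
      using B by eventually_elim (simp add: norm_mult norm_power mult_right_mono)
    then show "AE u in circle. norm (g u * complex_of_real ((norm (q u))\<^sup>2)) \<le> B * (norm (q u))\<^sup>2" .
    show "integrable circle (\<lambda>u. norm (g u * complex_of_real ((norm (q u))\<^sup>2)))"
    proof (rule Bochner_Integration.integrable_bound[OF integrable_mult_right[OF qi, of B]])
      show "(\<lambda>u. norm (g u * complex_of_real ((norm (q u))\<^sup>2))) \<in> borel_measurable circle"
        using g Lq_measurable[OF q2] by measurable
      show "AE u in circle. norm (norm (g u * complex_of_real ((norm (q u))\<^sup>2))) \<le> norm (B * (norm (q u))\<^sup>2)"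
        using bd by eventually_elim simp
    qed
  qed (use qi in simp)
  also have "\<dots> = 2 * pi * (B * (real n + 1))"
    using nq by (simp add: L2_nrm_sq)
  finally have "2 * pi * norm (fejer_sum (\<lambda>k. fc g k * chr k t) n) \<le> 2 * pi * (B * (real n + 1))"
    unfolding eq [symmetric] by (simp add: norm_mult)
  then show ?thesis by simp
qed

text \<open>The triangular factor makes \<open>M\<close> vanish at \<open>N + 1\<close>, which
  removes the Dirichlet boundary term, the one that positivity does not control. Each remaining
  Fejer sum of order \<open>n\<close> costs \<open>B * (n + 1)\<close>.\<close>

lemma fejer_multiplier_bound:
  fixes u :: "nat \<Rightarrow> real"
  assumes g: "g \<in> borel_measurable circle" and B: "AE t in circle. norm (g t) \<le> B" "0 \<le> B"
    and u: "mono u" "0 \<le> u 0"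
  shows "norm (tpoly {- int N..int N} (\<lambda>k. of_real (u (nat \<bar>k\<bar>) * (1 - \<bar>k\<bar> / (real N + 1))) * fc g k) t)
    \<le> B * ((\<Sum>n\<le>N. (real n + 1) * \<bar>u n - 2 * u (n + 1) + u (n + 2)\<bar>) + 3 * u (N + 2))"
proof -
  define M where "M n = u n * (1 - n / (real N + 1))" for n
  define a where "a k = fc g k * chr k t" for k
  define S where "S = fejer_sum a"
  have S: "norm (S n) \<le> B * (real n + 1)" for n
    unfolding S_def a_def using g B by (intro fejer_sum_fc_bound)
  have u0: "0 \<le> u n" for n using u by (meson monoD order_trans le0)
  \<comment> \<open>\<open>M (N + 2)\<close> lies outside the triangle and is nonpositive; after
    multiplication by the Fejer sum bound it contributes the boundary term
    \<open>u (N + 2)\<close>.\<close>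
  have M1: "M (N + 1) = 0" and M2: "M (N + 2) = - (u (N + 2) / (real N + 1))"
    by (auto simp: M_def field_simps)
  have "tpoly {- int N..int N} (\<lambda>k. of_real (u (nat \<bar>k\<bar>) * (1 - \<bar>k\<bar> / (real N + 1))) * fc g k) t
      = (\<Sum>k\<in>{- int N..int N}. of_real (M (nat \<bar>k\<bar>)) * a k)"
    unfolding tpoly_def a_def M_def by (intro sum.cong refl) (simp add: mult.assoc)
  also have "\<dots> = (\<Sum>n\<le>N. of_real (M n - 2 * M (n + 1) + M (n + 2)) * S n) + of_real (u (N + 2) / (real N + 1)) * S N"
    using second_summation_by_parts[of M a N] unfolding M1 M2 S_def by simp
  also have "norm \<dots> \<le> (\<Sum>n\<le>N. \<bar>M n - 2 * M (n + 1) + M (n + 2)\<bar> * (B * (real n + 1)))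
      + u (N + 2) / (real N + 1) * (B * (real N + 1))"
  proof (intro order_trans[OF norm_triangle_ineq] add_mono order_trans[OF norm_sum] sum_mono)
    show "norm (of_real (M n - 2 * M (n + 1) + M (n + 2)) * S n)
        \<le> \<bar>M n - 2 * M (n + 1) + M (n + 2)\<bar> * (B * (real n + 1))" for n
      unfolding norm_mult norm_of_real by (intro mult_left_mono S) simp
    show "norm (of_real (u (N + 2) / (real N + 1)) * S N) \<le> u (N + 2) / (real N + 1) * (B * (real N + 1))"
      unfolding norm_mult norm_of_real using u0[of "N + 2"] S[of N] by (intro mult_mono) auto
  qed
  also have "\<dots> = B * ((\<Sum>n\<le>N. (real n + 1) * \<bar>M n - 2 * M (n + 1) + M (n + 2)\<bar>) + u (N + 2))"
    by (simp add: distrib_left sum_distrib_left mult_ac field_simps)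
  also have "\<dots> \<le> B * ((\<Sum>n\<le>N. (real n + 1) * \<bar>u n - 2 * u (n + 1) + u (n + 2)\<bar> + 2 * (u (n + 2) - u (n + 1))) + u (N + 2))"
  proof (intro mult_left_mono add_mono sum_mono order.refl B(2))
    fix n assume "n \<in> {..N}"
    then have n: "n \<le> N" by simp
    define w where "w = 1 - n / (real N + 1)"
    have w: "0 \<le> w" "w \<le> 1" using n by (auto simp: w_def field_simps)
    \<comment> \<open>Discrete product rule: the weight is affine in \<open>n\<close>, so its second
      difference vanishes and only its slope \<open>- 1 / (N + 1)\<close> enters besides
      \<open>w\<close>.\<close>
    have M': "M n - 2 * M (n + 1) + M (n + 2)
        = w * (u n - 2 * u (n + 1) + u (n + 2)) - 2 / (real N + 1) * (u (n + 2) - u (n + 1))"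
    proof -
      define c where "c = 1 / (real N + 1)"
      have "n / (real N + 1) = n * c" "(n + 1) / (real N + 1) = (n + 1) * c" "(n + 2) / (real N + 1) = (n + 2) * c" "2 / (real N + 1) = 2 * c"
        by (simp_all add: c_def)
      then show ?thesis unfolding M_def w_def by (simp add: algebra_simps)
    qed
    have d: "0 \<le> u (n + 2) - u (n + 1)" using monoD[OF u(1), of "n + 1" "n + 2"] by simp
    have "\<bar>w * (u n - 2 * u (n + 1) + u (n + 2))\<bar> \<le> \<bar>u n - 2 * u (n + 1) + u (n + 2)\<bar>"
      using w by (simp add: abs_mult mult_left_le_one_le)
    moreover have "\<bar>2 / (real N + 1) * (u (n + 2) - u (n + 1))\<bar> = 2 / (real N + 1) * (u (n + 2) - u (n + 1))"
      using d by (simp add: abs_mult)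
    ultimately have "\<bar>M n - 2 * M (n + 1) + M (n + 2)\<bar>
        \<le> \<bar>u n - 2 * u (n + 1) + u (n + 2)\<bar> + 2 / (real N + 1) * (u (n + 2) - u (n + 1))"
      unfolding M' by linarith
    then have "(real n + 1) * \<bar>M n - 2 * M (n + 1) + M (n + 2)\<bar>
        \<le> (real n + 1) * (\<bar>u n - 2 * u (n + 1) + u (n + 2)\<bar> + 2 / (real N + 1) * (u (n + 2) - u (n + 1)))"
      by (intro mult_left_mono) auto
    also have "\<dots> = (real n + 1) * \<bar>u n - 2 * u (n + 1) + u (n + 2)\<bar> + (real n + 1) / (real N + 1) * (2 * (u (n + 2) - u (n + 1)))"
      by (simp add: distrib_left)
    also have "(real n + 1) / (real N + 1) * (2 * (u (n + 2) - u (n + 1))) \<le> 1 * (2 * (u (n + 2) - u (n + 1)))"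
      using n d by (intro mult_right_mono) auto
    finally show "(real n + 1) * \<bar>M n - 2 * M (n + 1) + M (n + 2)\<bar>
        \<le> (real n + 1) * \<bar>u n - 2 * u (n + 1) + u (n + 2)\<bar> + 2 * (u (n + 2) - u (n + 1))" by simp
  qed
  also have "(\<Sum>n\<le>N. (real n + 1) * \<bar>u n - 2 * u (n + 1) + u (n + 2)\<bar> + 2 * (u (n + 2) - u (n + 1)))
      = (\<Sum>n\<le>N. (real n + 1) * \<bar>u n - 2 * u (n + 1) + u (n + 2)\<bar>) + 2 * (u (N + 2) - u 1)"
  proof -
    \<comment> \<open>As \<open>u\<close> is monotone, its first differences carry no absolute
      values and telescope. Twice this sum plus the boundary term gives the factor 3.\<close>
    have "(\<Sum>n\<le>N. u (n + 2) - u (n + 1)) = u (N + 2) - u 1" by (induction N) auto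
    then show ?thesis unfolding sum.distrib sum_distrib_left[symmetric] by simp
  qed
  also have "B * ((\<Sum>n\<le>N. (real n + 1) * \<bar>u n - 2 * u (n + 1) + u (n + 2)\<bar>) + 2 * (u (N + 2) - u 1) + u (N + 2))
      \<le> B * ((\<Sum>n\<le>N. (real n + 1) * \<bar>u n - 2 * u (n + 1) + u (n + 2)\<bar>) + 3 * u (N + 2))"
    using u0[of 1] B(2) by (intro mult_left_mono) auto
  finally show ?thesis .
qed

section \<open>Second differences of the multiplier
  \<open>(1 + k\<^sup>2) powr \<sigma>\<close>\<close>

text \<open>The second derivative is a nonnegative multiple of
  \<open>1 - (1 - 2 * \<sigma>) * x\<^sup>2\<close>, hence nonpositive from
  \<open>1 / sqrt (1 - 2 * \<sigma>)\<close> on. For \<open>\<sigma> = 1 - s / 2\<close> the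
  condition \<open>\<sigma> < 1 / 2\<close> says \<open>1 < s\<close>.\<close>

lemma one_plus_sq_powr_concave:
  assumes "0 \<le> \<sigma>" "\<sigma> < 1 / 2"
  shows "concave_on {1 / sqrt (1 - 2 * \<sigma>)..} (\<lambda>x::real. (1 + x\<^sup>2) powr \<sigma>)"
proof (rule f''_le0_imp_concave)
  fix x :: real
  have p: "0 < 1 + x\<^sup>2" by (smt (verit) zero_le_power2)
  show "((\<lambda>x. (1 + x\<^sup>2) powr \<sigma>) has_real_derivative (2 * \<sigma>) * (x * (1 + x\<^sup>2) powr (\<sigma> - 1))) (at x)"
    using p by (auto intro!: derivative_eq_intros simp: powr_diff field_simps)
  show "((\<lambda>x. (2 * \<sigma>) * (x * (1 + x\<^sup>2) powr (\<sigma> - 1))) has_real_derivative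
      (2 * \<sigma>) * ((1 + x\<^sup>2) powr (\<sigma> - 2) * (1 - (1 - 2 * \<sigma>) * x\<^sup>2))) (at x)"
  proof -
    have "((\<lambda>x. (2 * \<sigma>) * (x * (1 + x\<^sup>2) powr (\<sigma> - 1))) has_real_derivative
      (2 * \<sigma>) * ((1 + x\<^sup>2) powr (\<sigma> - 1) + x * ((\<sigma> - 1) * (1 + x\<^sup>2) powr (\<sigma> - 1 - 1) * (2 * x)))) (at x)"
      using p by (auto intro!: derivative_eq_intros)
    moreover have "(1 + x\<^sup>2) powr (\<sigma> - 1) = (1 + x\<^sup>2) powr (\<sigma> - 2) * (1 + x\<^sup>2)"
      using p powr_add[of "1 + x\<^sup>2" "\<sigma> - 2" 1] by simp
    ultimately show ?thesis
      by (simp add: algebra_simps power2_eq_square)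
  qed
  assume x: "x \<in> {1 / sqrt (1 - 2 * \<sigma>)..}"
  have "(1 / sqrt (1 - 2 * \<sigma>))\<^sup>2 \<le> x\<^sup>2"
    using x assms by (intro power_mono) auto
  then have "1 \<le> (1 - 2 * \<sigma>) * x\<^sup>2"
    using assms by (simp add: power_divide field_simps)
  then show "(2 * \<sigma>) * ((1 + x\<^sup>2) powr (\<sigma> - 2) * (1 - (1 - 2 * \<sigma>) * x\<^sup>2)) \<le> 0"
    using assms by (intro mult_nonneg_nonpos) auto
qed simp

text \<open>This is the cost of the multiplier \<open>u\<close> in
  \<open>fejer_multiplier_bound\<close>; for \<open>\<sigma> = 1 - s / 2\<close> it grows at most
  like \<open>(N + 1) powr (2 - s)\<close>.\<close>

lemma second_difference_sum_le:
  fixes \<sigma> :: real and u :: "nat \<Rightarrow> real"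
  assumes \<sigma>: "0 \<le> \<sigma>" "\<sigma> < 1 / 2"
  defines "u \<equiv> \<lambda>n::nat. (1 + (real n)\<^sup>2) powr \<sigma>"
  obtains C where "0 \<le> C"
    "\<And>N. (\<Sum>n\<le>N. (real n + 1) * \<bar>u n - 2 * u (n + 1) + u (n + 2)\<bar>) + 3 * u (N + 2) \<le> C * (real N + 1) powr (2 * \<sigma>)"
proof -
  \<comment> \<open>From \<open>n0\<close> on \<open>u\<close> is concave, so up to finitely many terms \<open>\<bar>d n\<bar> = - d n\<close> and the sum telescopes.\<close>
  define d where "d n = u n - 2 * u (n + 1) + u (n + 2)" for n
  define x0 where "x0 = 1 / sqrt (1 - 2 * \<sigma>)"
  define n0 where "n0 = nat \<lceil>x0\<rceil>"
  have d_nonpos: "d n \<le> 0" if "n0 \<le> n" for n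
  proof -
    have x: "x0 \<le> real n" using that unfolding n0_def by linarith
    have "- ((1 + ((1 - 1/2) *\<^sub>R real n + (1/2) *\<^sub>R real (n + 2))\<^sup>2) powr \<sigma>)
        \<le> (1 - 1/2) * - ((1 + (real n)\<^sup>2) powr \<sigma>) + 1/2 * - ((1 + (real (n + 2))\<^sup>2) powr \<sigma>)"
      using one_plus_sq_powr_concave[OF \<sigma>] x
      unfolding concave_on_def x0_def [symmetric] by (intro convex_onD) auto
    moreover have "(1 - 1/2) *\<^sub>R real n + (1/2) *\<^sub>R real (n + 2) = real (n + 1)" by (simp add: field_simps)
    ultimately show ?thesis unfolding d_def u_def by simp
  qed
  have mono: "u m \<le> u n" if "m \<le> n" for m n
    unfolding u_def using that \<sigma> by (intro powr_mono2) (auto intro: power_mono)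
  have u0: "0 \<le> u n" for n by (simp add: u_def)
  \<comment> \<open>Independent of \<open>N\<close>. The factor 2 comes from
    \<open>\<bar>d\<bar> = - d + 2 * max d 0\<close>, where the maximum vanishes from
    \<open>n0\<close> on.\<close>
  define C0 where "C0 = (\<Sum>n<n0. 2 * (real n + 1) * \<bar>d n\<bar>)"
  have C0: "0 \<le> C0" unfolding C0_def by (intro sum_nonneg) auto
  have u_le: "u (N + 2) \<le> 5 * (real N + 1) powr (2 * \<sigma>)" for N
  proof -
    \<comment> \<open>Equality at \<open>N = 0\<close> dictates the constant 5.\<close>
    have "1 + (real (N + 2))\<^sup>2 \<le> 5 * (real N + 1)\<^sup>2" by (simp add: power2_eq_square algebra_simps)
    then have "u (N + 2) \<le> (5 * (real N + 1)\<^sup>2) powr \<sigma>"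
      unfolding u_def using \<sigma> by (intro powr_mono2) auto
    also have "\<dots> = 5 powr \<sigma> * (real N + 1) powr (2 * \<sigma>)"
    proof -
      have "(real N + 1)\<^sup>2 = (real N + 1) powr 2" by simp
      then show ?thesis by (simp add: powr_mult powr_powr del: powr_numeral)
    qed
    also have "\<dots> \<le> 5 powr 1 * (real N + 1) powr (2 * \<sigma>)"
      using \<sigma> by (intro mult_right_mono powr_mono) auto
    finally show ?thesis by simp
  qed
  have "(\<Sum>n\<le>N. (real n + 1) * \<bar>d n\<bar>) + 3 * u (N + 2) \<le> (C0 + 20) * (real N + 1) powr (2 * \<sigma>)" for N
  proof -
    have "(\<Sum>n\<le>N. (real n + 1) * \<bar>d n\<bar>) = (\<Sum>n\<le>N. (real n + 1) * (- d n)) + (\<Sum>n\<le>N. 2 * (real n + 1) * max (d n) 0)"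
      unfolding sum.distrib [symmetric] by (intro sum.cong refl) (auto simp: max_def algebra_simps)
    \<comment> \<open>Abel summation: against the weights \<open>n + 1\<close> the second
      differences collapse to boundary terms, which monotonicity of \<open>u\<close> then
      bounds.\<close>
    also have "(\<Sum>n\<le>N. (real n + 1) * (- d n)) = - u 0 + (N + 2) * u (N + 1) - (N + 1) * u (N + 2)"
      by (induction N) (auto simp: d_def algebra_simps numeral_2_eq_2)
    also have "\<dots> \<le> u (N + 2)"
      using u0[of 0] u0[of "N+1"] mono[of "N + 1" "N + 2"] mult_left_mono[OF mono[of "N + 1" "N + 2"], of "real N + 1"]
      by (simp add: algebra_simps)
    also have "(\<Sum>n\<le>N. 2 * (real n + 1) * max (d n) 0) \<le> C0"
    proof -
      have "(\<Sum>n\<le>N. 2 * (real n + 1) * max (d n) 0) \<le> (\<Sum>n\<in>{..N} \<union> {..<n0}. 2 * (real n + 1) * max (d n) 0)"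
        by (intro sum_mono2) auto
      also have "\<dots> = (\<Sum>n<n0. 2 * (real n + 1) * max (d n) 0)"
        using d_nonpos by (intro sum.mono_neutral_right) (auto simp: not_less max_def intro: antisym)
      also have "\<dots> \<le> C0" unfolding C0_def by (intro sum_mono mult_left_mono) auto
      finally show ?thesis .
    qed
    finally have "(\<Sum>n\<le>N. (real n + 1) * \<bar>d n\<bar>) + 3 * u (N + 2) \<le> C0 + 4 * u (N + 2)" by simp
    also have "\<dots> \<le> C0 * (real N + 1) powr (2 * \<sigma>) + 20 * (real N + 1) powr (2 * \<sigma>)"
      using C0 u_le[of N] \<sigma> ge_one_powr_ge_zero[of "real N + 1" "2 * \<sigma>"]
        mult_left_mono[of 1 "(real N + 1) powr (2 * \<sigma>)" C0] by auto
    finally show ?thesis by (simp add: distrib_right)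
  qed
  then show ?thesis
    by (intro that[of "C0 + 20"]) (use C0 in \<open>simp_all add: d_def\<close>)
qed

section \<open>Density of trigonometric polynomials\<close>

text \<open>A real linear form in \<open>cis t\<close> is a combination of \<open>cos t\<close> and
  \<open>sin t\<close>, hence of the frequencies 1 and -1; sums and products of trigonometric
  polynomials are again such.\<close>

lemma real_polynomial_function_cis:
  fixes r :: "complex \<Rightarrow> real"
  assumes "real_polynomial_function r"
  shows "(\<lambda>t. complex_of_real (r (cis t))) \<in> trig_polys"
  using assms
proof induction
  case (linear f)
  then interpret f: bounded_linear f .
  have "complex_of_real (f (cis t))
      = (complex_of_real (f 1) - \<i> * complex_of_real (f \<i>)) / 2 * chr 1 t
        + (complex_of_real (f 1) + \<i> * complex_of_real (f \<i>)) / 2 * chr (- 1) t" for t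
  proof -
    have "cis t = cos t *\<^sub>R 1 + sin t *\<^sub>R \<i>" by (simp add: complex_eq_iff)
    then have "f (cis t) = cos t * f 1 + sin t * f \<i>" by (simp only: f.add f.scaleR real_scaleR_def)
    then show ?thesis by (simp add: complex_eq_iff field_simps)
  qed
  then show ?case by (simp only: trig_polys_add trig_polys_chr)
next
  case (const c)
  then show ?case by (rule trig_polys_const)
next
  case (add f g)
  then show ?case using trig_polys_add by fastforce
next
  case (mult f g)
  then show ?case using trig_polys_mult by fastforce
qed

text \<open>Since its end values agree, \<open>c\<close> can be transplanted to the unit circle by
  \<open>Arg2pi\<close>. Stone-Weierstrass approximates it there by a polynomial, which is read back
  along \<open>cis\<close>.\<close>

lemma trig_polys_uniform_approx:
  fixes c :: "real \<Rightarrow> real"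
  assumes c: "continuous_on {0..2 * pi} c" "c 0 = c (2 * pi)" and "0 < e"
  obtains p where "p \<in> trig_polys" "\<And>t. t \<in> {0..<2 * pi} \<Longrightarrow> norm (complex_of_real (c t) - p t) < e"
proof -
  define l where "l x = complex_of_real (c (2 * pi * x))" for x
  have "path l"
    unfolding path_def l_def
    by (intro continuous_intros continuous_on_compose2[OF c(1)]) auto
  moreover have "pathfinish l = pathstart l" using c(2) by (simp add: l_def pathfinish_def pathstart_def)
  \<comment> \<open>The constant homotopy of the loop \<open>l\<close> yields continuity of the
    induced map on the whole circle, also at 1 where \<open>Arg2pi\<close> jumps.\<close>
  ultimately have "homotopic_loops UNIV l l" by (simp add: homotopic_loops_refl)
  from homotopic_with_imp_continuous[OF homotopic_loops_imp_homotopic_circlemaps[OF this]]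
  have "continuous_on (sphere 0 1) (l \<circ> (\<lambda>z. Arg2pi z / (2 * pi)))" by simp
  from Stone_Weierstrass_polynomial_function[OF compact_sphere this \<open>0 < e\<close>]
  obtain g where g: "polynomial_function g"
    "\<And>z. z \<in> sphere 0 1 \<Longrightarrow> norm ((l \<circ> (\<lambda>z. Arg2pi z / (2 * pi))) z - g z) < e" by blast
  let ?p = "\<lambda>t. complex_of_real ((Re \<circ> g) (cis t)) + \<i> * complex_of_real ((Im \<circ> g) (cis t))"
  have "real_polynomial_function (Re \<circ> g)" "real_polynomial_function (Im \<circ> g)"
    using g(1) unfolding polynomial_function_def by (auto intro: bounded_linear_Re bounded_linear_Im)
  then have "?p \<in> trig_polys"
    by (intro trig_polys_add trig_polys_mult trig_polys_const real_polynomial_function_cis)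
  moreover have "norm (complex_of_real (c t) - ?p t) < e" if "t \<in> {0..<2 * pi}" for t
  proof -
    have "Arg2pi (cis t) = t"
      using that by (intro Arg2pi_unique[of 1]) (auto simp: cis_conv_exp)
    moreover have "?p t = g (cis t)" by (simp add: complex_eq_iff)
    ultimately show ?thesis using g(2)[of "cis t"] by (simp add: l_def)
  qed
  ultimately show ?thesis by (rule that)
qed

text \<open>This property passes to dominated limits, so density is reached in three stages: bounded
  continuous, bounded measurable and square integrable functions.\<close>

definition L2_approx :: "(real \<Rightarrow> real) \<Rightarrow> bool" where
  "L2_approx f \<longleftrightarrow> (\<forall>e>0. \<exists>p\<in>trig_polys. L2_nrm circle (\<lambda>t. complex_of_real (f t) - p t) < e)"

text \<open>Dominated convergence with majorant \<open>4 * (G t)\<^sup>2\<close> makes some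
  \<open>X n\<close> close to \<open>f\<close> in the norm; a polynomial close to \<open>X n\<close>
  then works for \<open>f\<close>.\<close>

lemma L2_approx_limit:
  assumes X: "\<And>n. X n \<in> borel_measurable circle" and f: "f \<in> borel_measurable circle"
    and G: "G \<in> Lq circle 2"
    and lim: "AE t in circle. (\<lambda>n. X n t) \<longlonglongrightarrow> f t"
    and dom: "\<And>n. AE t in circle. \<bar>X n t\<bar> \<le> G t" "AE t in circle. \<bar>f t\<bar> \<le> G t"
    and approx: "\<And>n. L2_approx (X n)"
  shows "L2_approx f"
  unfolding L2_approx_def
proof (intro allI impI)
  fix e :: real assume e: "0 < e"
  have Gi: "integrable circle (\<lambda>t. (G t)\<^sup>2)" using G by (simp add: Lq_2_iff)
  have Gm: "G \<in> borel_measurable circle" by (rule Lq_measurable[OF G])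
  have L2: "(\<lambda>t. complex_of_real (h t)) \<in> Lq circle 2"
    if "h \<in> borel_measurable circle" "AE t in circle. \<bar>h t\<bar> \<le> G t" for h
  proof (rule of_real_Lq_2)
    have "integrable circle (\<lambda>t. (norm (h t))\<^sup>2)"
    proof (rule Bochner_Integration.integrable_bound[OF Gi])
      show "(\<lambda>t. (norm (h t))\<^sup>2) \<in> borel_measurable circle" using that(1) by measurable
      show "AE t in circle. norm ((norm (h t))\<^sup>2) \<le> norm ((G t)\<^sup>2)"
        using that(2) by eventually_elim (auto intro: power_mono simp: abs_le_square_iff[symmetric])
    qed
    then show "h \<in> Lq circle 2" using that(1) unfolding Lq_2_iff by simp
  qed
  have "(\<lambda>n. \<integral>t. (X n t - f t)\<^sup>2 \<partial>circle) \<longlonglongrightarrow> (\<integral>t. 0 \<partial>circle)"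
  proof (rule integral_dominated_convergence)
    show "integrable circle (\<lambda>t. 4 * (G t)\<^sup>2)" using Gi by simp
    show "AE t in circle. (\<lambda>n. (X n t - f t)\<^sup>2) \<longlonglongrightarrow> 0"
      using lim
    proof eventually_elim
      case (elim t)
      then show ?case using tendsto_power[OF tendsto_diff[OF elim tendsto_const[of "f t"]], of 2] by simp
    qed
    show "AE t in circle. norm ((X n t - f t)\<^sup>2) \<le> 4 * (G t)\<^sup>2" for n
      using dom(1)[of n] dom(2)
    proof eventually_elim
      case (elim t)
      then have "\<bar>X n t - f t\<bar>\<^sup>2 \<le> (2 * G t)\<^sup>2" by (intro power_mono) auto
      then show ?case by simp
    qed
    show "(\<lambda>t. (X n t - f t)\<^sup>2) \<in> borel_measurable circle" for n
      using X f by measurable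
  qed simp
  then have "(\<lambda>n. sqrt (\<integral>t. (X n t - f t)\<^sup>2 \<partial>circle)) \<longlonglongrightarrow> sqrt 0"
    by (intro tendsto_real_sqrt) simp
  then have "(\<lambda>n. sqrt (\<integral>t. (X n t - f t)\<^sup>2 \<partial>circle)) \<longlonglongrightarrow> 0" by simp
  from order_tendstoD(2)[OF this, of "e / 2"] e obtain n where
    n: "sqrt (\<integral>t. (X n t - f t)\<^sup>2 \<partial>circle) < e / 2"
    by (auto simp: eventually_sequentially)
  have "L2_nrm circle (\<lambda>t. complex_of_real (f t) - complex_of_real (X n t)) < e / 2"
    using n unfolding L2_nrm_def by (simp add: power2_commute flip: of_real_diff)
  moreover obtain p where p: "p \<in> trig_polys" "L2_nrm circle (\<lambda>t. complex_of_real (X n t) - p t) < e / 2"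
    using approx[of n] e unfolding L2_approx_def by (meson half_gt_zero)
  moreover have "L2_nrm circle (\<lambda>t. (complex_of_real (f t) - complex_of_real (X n t)) + (complex_of_real (X n t) - p t))
      \<le> L2_nrm circle (\<lambda>t. complex_of_real (f t) - complex_of_real (X n t)) + L2_nrm circle (\<lambda>t. complex_of_real (X n t) - p t)"
    by (intro L2_nrm_triangle Lq_2_diff L2 f X dom trig_polys_Lq_2 p)
  ultimately show "\<exists>p\<in>trig_polys. L2_nrm circle (\<lambda>t. complex_of_real (f t) - p t) < e"
    by (intro bexI[of _ p]) auto
qed

lemma const_Lq_2: "(\<lambda>_. B) \<in> Lq circle 2"
  by (rule circle.bounded_imp_Lq_2[where B = "norm B"]) auto

lemma AE_circle: "(AE t in lborel. P t) \<Longrightarrow> AE t in circle. P t"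
  unfolding circle_def by (subst AE_restrict_space_iff) auto

lemma AE_circle_pos: "AE t in circle. 0 < t \<and> t < 2 * pi"
proof -
  have "AE t in circle. t \<noteq> 0" by (rule AE_circle[OF AE_lborel_singleton])
  moreover have "AE t in circle. t \<in> space circle" by (rule AE_space)
  ultimately show ?thesis by eventually_elim auto
qed

lemma L2_approx_continuous:
  fixes c :: "real \<Rightarrow> real"
  assumes c: "continuous_on UNIV c" and B: "\<And>t. \<bar>c t\<bar> \<le> B"
  shows "L2_approx c"
proof (rule L2_approx_limit[where G = "\<lambda>_. B"])
  \<comment> \<open>The cut-off vanishes at \<open>0\<close> and \<open>2 * pi\<close>, which makes the approximants periodic.\<close>
  let ?F = "\<lambda>n t. c t * min 1 (real n * min t (2 * pi - t))"
  have contF: "continuous_on UNIV (?F n)" for n by (intro continuous_intros c)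
  show "?F n \<in> borel_measurable circle" for n by (rule circle_continuous[OF contF])
  show "c \<in> borel_measurable circle" by (rule circle_continuous[OF c])
  show "(\<lambda>_. B) \<in> Lq circle 2" by (rule const_Lq_2)
  show "AE t in circle. \<bar>c t\<bar> \<le> B" using B by simp
  show "AE t in circle. (\<lambda>n. ?F n t) \<longlonglongrightarrow> c t"
    using AE_circle_pos
  proof eventually_elim
    case (elim t)
    define m where "m = min t (2 * pi - t)"
    have m: "0 < m" using elim by (auto simp: m_def)
    obtain N where N: "1 / m < real N" using reals_Archimedean2 by blast
    have "eventually (\<lambda>n. ?F n t = c t) sequentially"
      using eventually_ge_at_top[of N]
    proof eventually_elim
      case (elim n)
      then have "1 / m \<le> real n" using N by linarith
      then have "1 \<le> real n * m" using m by (simp add: field_simps)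
      then show ?case by (simp add: m_def)
    qed
    then show ?case by (rule tendsto_eventually)
  qed
  show "AE t in circle. \<bar>?F n t\<bar> \<le> B" for n
    using AE_circle_pos
  proof eventually_elim
    case (elim t)
    then have "0 \<le> min t (2 * pi - t)" by auto
    then have "0 \<le> real n * min t (2 * pi - t)" by (intro mult_nonneg_nonneg) auto
    then have "\<bar>min 1 (real n * min t (2 * pi - t))\<bar> \<le> 1" by linarith
    then have "\<bar>?F n t\<bar> \<le> \<bar>c t\<bar> * 1" unfolding abs_mult by (intro mult_left_mono) auto
    then show ?case using B[of t] by simp
  qed
  show "L2_approx (?F n)" for n
    unfolding L2_approx_def
  proof (intro allI impI)
    fix e :: real assume e: "0 < e"
    define d where "d = e / (2 * sqrt (2 * pi))"
    have d: "0 < d" using e by (simp add: d_def)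
    obtain p where p: "p \<in> trig_polys" "\<And>t. t \<in> {0..<2 * pi} \<Longrightarrow> norm (complex_of_real (?F n t) - p t) < d"
      by (rule trig_polys_uniform_approx[of "?F n" d]) (use d continuous_on_subset[OF contF subset_UNIV] in auto)
    have "L2_nrm circle (\<lambda>t. complex_of_real (?F n t) - p t) \<le> d * sqrt (measure circle (space circle))"
    proof (rule circle.L2_nrm_le_bound)
      show "(\<lambda>t. complex_of_real (?F n t) - p t) \<in> borel_measurable circle"
        by (rule borel_measurable_diff[OF circle_continuous[OF continuous_on_of_real[OF contF[of n]]]
              Lq_measurable[OF trig_polys_Lq_2[OF p(1)]]])
    qed (use p d less_imp_le in auto)
    also have "\<dots> = e / 2" by (simp add: d_def)
    also have "\<dots> < e" using e by simp
    finally show "\<exists>p\<in>trig_polys. L2_nrm circle (\<lambda>t. complex_of_real (?F n t) - p t) < e"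
      using p(1) by blast
  qed
qed

text \<open>A measurable function is almost everywhere a limit of continuous ones. Clamping these to
  the range from \<open>- B\<close> to \<open>B\<close> keeps the limit and provides a constant
  majorant.\<close>

lemma L2_approx_bounded:
  fixes f :: "real \<Rightarrow> real"
  assumes f: "f \<in> borel_measurable circle" and B: "\<And>t. \<bar>f t\<bar> \<le> B"
  shows "L2_approx f"
proof -
  define f' where "f' t = indicator {0..<2*pi} t *\<^sub>R f t" for t
  have "f' \<in> borel_measurable lborel"
    using f unfolding circle_def f'_def by (subst (asm) borel_measurable_restrict_space_iff) auto
  then have "f' \<in> borel_measurable lebesgue"
    by (simp add: measurable_completion)
  then have "f' measurable_on UNIV"
    by (rule lebesgue_measurable_imp_measurable_on_real) simp
  then obtain N g where N: "negligible N" and g: "\<And>n. continuous_on UNIV (g n)"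
    and lim: "\<And>x. x \<notin> N \<Longrightarrow> (\<lambda>n. g n x) \<longlonglongrightarrow> f' x"
    unfolding measurable_on_def by auto
  have B0: "0 \<le> B" using B[of 0] by linarith
  let ?F = "\<lambda>n t. max (- B) (min B (g n t))"
  have contF: "continuous_on UNIV (?F n)" for n by (intro continuous_intros g)
  show ?thesis
  proof (rule L2_approx_limit[where G = "\<lambda>_. B" and X = ?F])
    show "?F n \<in> borel_measurable circle" for n by (rule circle_continuous[OF contF])
    show "(\<lambda>_. B) \<in> Lq circle 2" by (rule const_Lq_2)
    show "L2_approx (?F n)" for n
      by (rule L2_approx_continuous[OF contF, of _ B]) (use B0 in auto)
    have "AE t in lebesgue. t \<notin> N"
      using N by (simp add: negligible_iff_null_sets AE_not_in)
    then have "AE t in lborel. t \<notin> N" by (simp add: AE_completion_iff)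
    then have "AE t in circle. t \<notin> N" by (rule AE_circle)
    moreover have "AE t in circle. t \<in> space circle" by (rule AE_space)
    ultimately show "AE t in circle. (\<lambda>n. ?F n t) \<longlonglongrightarrow> f t"
    proof eventually_elim
      case (elim t)
      have "(\<lambda>n. ?F n t) \<longlonglongrightarrow> max (- B) (min B (f' t))"
        by (intro tendsto_intros lim elim)
      moreover have "max (- B) (min B (f' t)) = f t" using elim B[of t] by (simp add: f'_def)
      ultimately show ?case by simp
    qed
    show "AE t in circle. \<bar>?F n t\<bar> \<le> B" for n using B0 by (intro AE_I2) auto
  qed (use f B in auto)
qed

text \<open>The truncations of \<open>f\<close> at height \<open>n\<close> are bounded, converge
  pointwise and are dominated by \<open>\<bar>f\<bar>\<close>.\<close>

lemma trig_polys_dense: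
  fixes f :: "real \<Rightarrow> real"
  assumes f: "f \<in> Lq circle 2" and e: "0 < e"
  obtains p where "p \<in> trig_polys" "L2_nrm circle (\<lambda>t. complex_of_real (f t) - p t) < e"
proof -
  let ?F = "\<lambda>n t. max (- real n) (min (real n) (f t))"
  have m: "f \<in> borel_measurable circle" by (rule Lq_measurable[OF f])
  have Fm: "?F n \<in> borel_measurable circle" for n using m by measurable
  have "L2_approx f"
  proof (rule L2_approx_limit[where G = "\<lambda>t. \<bar>f t\<bar>" and X = ?F])
    show "L2_approx (?F n)" for n
      by (rule L2_approx_bounded[OF Fm, of _ "real n"]) auto
    show "(\<lambda>t. \<bar>f t\<bar>) \<in> Lq circle 2" using f m unfolding Lq_2_iff by simp
    show "AE t in circle. (\<lambda>n. ?F n t) \<longlonglongrightarrow> f t"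
    proof (rule AE_I2)
      fix t
      obtain N where N: "\<bar>f t\<bar> < real N" using reals_Archimedean2 by blast
      have "eventually (\<lambda>n. ?F n t = f t) sequentially"
        using eventually_ge_at_top[of N] by eventually_elim (use N in auto)
      then show "(\<lambda>n. ?F n t) \<longlonglongrightarrow> f t" by (rule tendsto_eventually)
    qed
  qed (use m Fm in auto)
  then show ?thesis using e that unfolding L2_approx_def by blast
qed

section \<open>Weak derivatives and the distance of hypographs\<close>

lemma continuous_AE_bound:
  assumes "continuous_on UNIV f"
  obtains A :: real where "0 \<le> A" "AE t in circle. norm (f t) \<le> A"
proof -
  have "bounded (f ` {0..2 * pi})"
    by (intro compact_imp_bounded compact_continuous_image continuous_on_subset[OF assms]) auto
  then obtain A where A: "\<forall>t\<in>{0..2 * pi}. norm (f t) \<le> A"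
    unfolding bounded_iff by blast
  then have "norm (f 0) \<le> A" by simp
  then have "0 \<le> A" using norm_ge_zero order_trans by blast
  moreover have "AE t in circle. norm (f t) \<le> A" using A by (intro AE_I2) auto
  ultimately show ?thesis by (rule that)
qed

lemma continuous_Lq_2:
  fixes f :: "real \<Rightarrow> 'b::{real_normed_vector, second_countable_topology}"
  assumes "continuous_on UNIV f" shows "f \<in> Lq circle 2"
proof (rule continuous_AE_bound[OF assms])
  fix A assume "AE t in circle. norm (f t) \<le> A"
  then show ?thesis by (rule circle.bounded_imp_Lq_2[OF circle_continuous[OF assms]])
qed

lemma fc_diff:
  assumes "f \<in> Lq circle 2" "g \<in> Lq circle 2"
  shows "fc (\<lambda>t. f t - g t) k = fc f k - fc g k"
  using Lq_2_mult_integrable[OF assms(1) chr_Lq_2[of "- k"]] Lq_2_mult_integrable[OF assms(2) chr_Lq_2[of "- k"]]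
  unfolding fc_def left_diff_distrib by (simp add: diff_divide_distrib)

text \<open>Density extends the estimate from trigonometric polynomials to \<open>E\<close>. A
  comparison of Fourier coefficients thus becomes a dual bound without Parseval's identity for
  \<open>f\<close>.\<close>

lemma L2_pairing_le:
  fixes E :: "real \<Rightarrow> real"
  assumes f: "f \<in> Lq circle 2" and g: "g \<in> Lq circle 2" and E: "E \<in> Lq circle 2" and "0 \<le> C"
    and bd: "\<And>k. norm (fc f k) \<le> C * norm (fc g k)"
  shows "norm (\<integral>t. f t * complex_of_real (E t) \<partial>circle) \<le> C * L2_nrm circle g * L2_nrm circle E"
proof (rule field_le_epsilon)
  fix e :: real assume e: "0 < e"
  let ?E = "\<lambda>t. complex_of_real (E t)"
  \<comment> \<open>\<open>K\<close> collects both approximation errors: the norm of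
    \<open>p\<close> exceeds that of \<open>E\<close> by at most \<open>d\<close>, and
    \<open>f\<close> is still paired with \<open>E - p\<close>. Dividing by \<open>K + 1\<close>
    covers the case \<open>K = 0\<close>.\<close>
  define K where "K = C * L2_nrm circle g + L2_nrm circle f"
  have K: "0 \<le> K" using \<open>0 \<le> C\<close> by (simp add: K_def L2_nrm_nonneg)
  define d where "d = e / (K + 1)"
  have d: "0 < d" "K * d \<le> e" using e K by (auto simp: d_def field_simps)
  obtain p where p: "p \<in> trig_polys" "L2_nrm circle (\<lambda>t. ?E t - p t) < d"
    by (rule trig_polys_dense[OF E d(1)])
  have E2: "?E \<in> Lq circle 2" by (rule of_real_Lq_2[OF E])
  have p2: "p \<in> Lq circle 2" by (rule trig_polys_Lq_2[OF p(1)])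
  have Ep: "(\<lambda>t. ?E t - p t) \<in> Lq circle 2" by (rule Lq_2_diff[OF E2 p2])
  have "(\<integral>t. f t * ?E t \<partial>circle) = (\<integral>t. f t * p t + f t * (?E t - p t) \<partial>circle)"
    by (simp add: algebra_simps)
  also have "\<dots> = (\<integral>t. f t * p t \<partial>circle) + (\<integral>t. f t * (?E t - p t) \<partial>circle)"
    by (intro Bochner_Integration.integral_add Lq_2_mult_integrable f p2 Ep)
  also have "norm \<dots> \<le> C * L2_nrm circle g * L2_nrm circle p + L2_nrm circle f * L2_nrm circle (\<lambda>t. ?E t - p t)"
    by (intro order_trans[OF norm_triangle_ineq] add_mono L2_pairing_trig_poly_le L2_Cauchy_Schwarz
        f g p(1) \<open>0 \<le> C\<close> bd Ep)
  also have "\<dots> \<le> C * L2_nrm circle g * (L2_nrm circle E + d) + L2_nrm circle f * d"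
  proof -
    have "L2_nrm circle (\<lambda>t. ?E t + (p t - ?E t)) \<le> L2_nrm circle ?E + L2_nrm circle (\<lambda>t. p t - ?E t)"
      by (rule L2_nrm_triangle[OF E2 Lq_2_diff[OF p2 E2]])
    then have "L2_nrm circle p \<le> L2_nrm circle E + d"
      using p(2) unfolding L2_nrm_minus_commute[of circle p] L2_nrm_of_real by simp
    then show ?thesis using p(2) \<open>0 \<le> C\<close>
      by (intro add_mono mult_left_mono mult_nonneg_nonneg L2_nrm_nonneg) auto
  qed
  also have "\<dots> = C * L2_nrm circle g * L2_nrm circle E + K * d"
    by (simp add: K_def algebra_simps)
  finally show "norm (\<integral>t. f t * ?E t \<partial>circle) \<le> C * L2_nrm circle g * L2_nrm circle E + e"
    using d(2) by linarith
qed

section \<open>Weak derivatives and the Sobolev seminorm\<close>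

lemma weak_deriv_spec:
  assumes "\<gamma> \<in> H1"
  shows "weak_deriv \<gamma> \<in> Lq circle 2" "has_weak_deriv \<gamma> (weak_deriv \<gamma>)"
  using assms someI_ex[of "\<lambda>g. g \<in> Lq circle 2 \<and> has_weak_deriv \<gamma> g"]
  unfolding H1_def weak_deriv_def by blast+

lemma fc_weak_deriv:
  assumes "has_weak_deriv \<gamma> g"
  shows "fc (\<lambda>t. complex_of_real (g t)) k = \<i> * of_int k * fc (\<lambda>t. complex_of_real (\<gamma> t)) k"
proof -
  have c: "chr (- k) = tpoly {- k} (\<lambda>_. 1)" by (simp add: tpoly_def fun_eq_iff)
  have "chr (- k) \<in> test_functions"
    unfolding c by (intro trig_polys_test tpoly_in_trig_polys) simp
  then have "dist_of (\<lambda>t. complex_of_real (\<gamma> t)) (vderiv (chr (- k))) = - dist_of (\<lambda>t. complex_of_real (g t)) (chr (- k))"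
    using assms unfolding has_weak_deriv_def by blast
  moreover have "vderiv (chr (- k)) = (\<lambda>t. (- \<i> * of_int k) * chr (- k) t)"
    unfolding c vderiv_tpoly by (simp add: tpoly_def fun_eq_iff)
  ultimately have "(\<integral>t. (- \<i> * of_int k) * (complex_of_real (\<gamma> t) * chr (- k) t) \<partial>circle)
      = - (\<integral>t. complex_of_real (g t) * chr (- k) t \<partial>circle)"
    unfolding dist_of_def by (simp only: mult.left_commute)
  then have "(- \<i> * of_int k) * (\<integral>t. (complex_of_real (\<gamma> t) * chr (- k) t) \<partial>circle)
      = - (\<integral>t. complex_of_real (g t) * chr (- k) t \<partial>circle)"
    by (simp only: integral_mult_right_zero)
  then have "(\<i> * of_int k) * (\<integral>t. (complex_of_real (\<gamma> t) * chr (- k) t) \<partial>circle)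
      = (\<integral>t. complex_of_real (g t) * chr (- k) t \<partial>circle)"
    by (simp only: mult_minus_left neg_equal_iff_equal)
  then show ?thesis unfolding fc_def by (simp only: times_divide_eq_right)
qed

text \<open>All Fourier coefficients of the difference vanish, so \<open>L2_pairing_le\<close> with
  constant 0, applied to the difference paired with itself, makes its norm vanish.\<close>

lemma has_weak_deriv_unique:
  assumes g: "g \<in> Lq circle 2" "has_weak_deriv \<gamma> g" and h: "h \<in> Lq circle 2" "has_weak_deriv \<gamma> h"
  shows "AE t in circle. g t = h t"
proof -
  let ?d = "\<lambda>t. g t - h t"
  have gh: "(\<lambda>t. complex_of_real (g t)) \<in> Lq circle 2" "(\<lambda>t. complex_of_real (h t)) \<in> Lq circle 2"
    by (rule of_real_Lq_2[OF g(1)], rule of_real_Lq_2[OF h(1)])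
  have d: "(\<lambda>t. complex_of_real (?d t)) \<in> Lq circle 2"
    using Lq_2_diff[OF gh] by simp
  have dr: "?d \<in> Lq circle 2" by (rule Lq_2_diff[OF g(1) h(1)])
  have "fc (\<lambda>t. complex_of_real (?d t)) k = 0" for k
    using fc_diff[OF gh, of k] fc_weak_deriv[OF g(2)] fc_weak_deriv[OF h(2)] by simp
  then have "norm (\<integral>t. complex_of_real (?d t) * complex_of_real (?d t) \<partial>circle) \<le> 0 * L2_nrm circle (\<lambda>t. complex_of_real (?d t)) * L2_nrm circle ?d"
    by (intro L2_pairing_le d dr) auto
  then have "(\<integral>t. complex_of_real (?d t * ?d t) \<partial>circle) = 0" by simp
  then have "(\<integral>t. ?d t * ?d t \<partial>circle) = 0"
    unfolding integral_complex_of_real by simp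
  then have "L2_nrm circle ?d = 0" by (simp add: L2_nrm_def power2_eq_square)
  from L2_nrm_eq_0_AE[OF dr this] show ?thesis by eventually_elim simp
qed

lemma has_weak_deriv_diff:
  assumes \<gamma>: "continuous_on UNIV \<gamma>" "g \<in> Lq circle 2" "has_weak_deriv \<gamma> g"
    and \<eta>: "continuous_on UNIV \<eta>" "h \<in> Lq circle 2" "has_weak_deriv \<eta> h"
  shows "has_weak_deriv (\<lambda>t. \<gamma> t - \<eta> t) (\<lambda>t. g t - h t)"
  unfolding has_weak_deriv_def
proof
  fix \<phi> assume \<phi>: "\<phi> \<in> test_functions"
  have cont: "continuous_on UNIV ((vderiv ^^ n) \<phi>)" for n
    using \<phi> unfolding test_functions_def by (auto intro: differentiable_imp_continuous_on)
  have c: "\<phi> \<in> Lq circle 2" "vderiv \<phi> \<in> Lq circle 2"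
    using continuous_Lq_2[OF cont[of 0]] continuous_Lq_2[OF cont[of 1]] by simp_all
  have diff: "dist_of (\<lambda>t. complex_of_real (a t - b t)) \<psi>
      = dist_of (\<lambda>t. complex_of_real (a t)) \<psi> - dist_of (\<lambda>t. complex_of_real (b t)) \<psi>"
    if "a \<in> Lq circle 2" "b \<in> Lq circle 2" "\<psi> \<in> Lq circle 2" for a b \<psi>
    unfolding dist_of_def
    using Lq_2_mult_integrable[OF of_real_Lq_2[OF that(1)] that(3)] Lq_2_mult_integrable[OF of_real_Lq_2[OF that(2)] that(3)]
    by (simp add: left_diff_distrib)
  show "dist_of (\<lambda>t. complex_of_real (\<gamma> t - \<eta> t)) (vderiv \<phi>) = - dist_of (\<lambda>t. complex_of_real (g t - h t)) \<phi>"
    unfolding diff[OF continuous_Lq_2[OF \<gamma>(1)] continuous_Lq_2[OF \<eta>(1)] c(2)] diff[OF \<gamma>(2) \<eta>(2) c(1)]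
    using \<gamma>(3) \<eta>(3) \<phi> unfolding has_weak_deriv_def by simp
qed

text \<open>\<open>weak_deriv\<close> is a choice, so the one chosen for
  \<open>\<gamma> - \<eta>\<close> need not be the difference \<open>E\<close> of the chosen ones;
  uniqueness up to null sets identifies the norms. The rest expands the square of
  \<open>weak_deriv \<eta> + E\<close>.\<close>

lemma H10_nrm_expansion:
  assumes \<gamma>: "\<gamma> \<in> H1" and \<eta>: "\<eta> \<in> H1"
  obtains E where "E \<in> Lq circle 2" "has_weak_deriv (\<lambda>t. \<gamma> t - \<eta> t) E"
    "H10_nrm (\<lambda>t. \<gamma> t - \<eta> t) = L2_nrm circle E"
    "(H10_nrm \<gamma>)\<^sup>2 - (H10_nrm \<eta>)\<^sup>2 = (L2_nrm circle E)\<^sup>2 + 2 * (\<integral>t. weak_deriv \<eta> t * E t \<partial>circle)"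
proof -
  let ?G = "weak_deriv \<gamma>" and ?D = "weak_deriv \<eta>" and ?h = "\<lambda>t. \<gamma> t - \<eta> t"
  define E where "E t = ?G t - ?D t" for t
  note G = weak_deriv_spec[OF \<gamma>] and D = weak_deriv_spec[OF \<eta>]
  have cont: "continuous_on UNIV \<gamma>" "continuous_on UNIV \<eta>" using \<gamma> \<eta> by (auto simp: H1_def)
  have E: "E \<in> Lq circle 2" unfolding E_def by (rule Lq_2_diff[OF G(1) D(1)])
  have wE: "has_weak_deriv ?h E"
    unfolding E_def by (rule has_weak_deriv_diff[OF cont(1) G cont(2) D])
  have ch: "continuous_on UNIV ?h" by (intro continuous_intros cont)
  have "?h \<in> H1"
  proof -
    have "periodic ?h" using \<gamma> \<eta> by (simp add: H1_def periodic_def)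
    with E wE ch continuous_Lq_2[OF ch] show ?thesis unfolding H1_def by blast
  qed
  note W = weak_deriv_spec[OF this]
  have "L2_nrm circle (weak_deriv ?h) = L2_nrm circle E"
    by (intro L2_nrm_cong_AE has_weak_deriv_unique[OF W E wE] Lq_measurable[OF W(1)] Lq_measurable[OF E])
  then have 1: "H10_nrm ?h = L2_nrm circle E" by (simp add: H10_nrm_def)
  have i: "integrable circle (\<lambda>t. ?D t * E t)"
    using integrable_Re[OF Lq_2_mult_integrable[OF of_real_Lq_2[OF D(1)] of_real_Lq_2[OF E]]]
    by simp
  have "(H10_nrm \<gamma>)\<^sup>2 = (\<integral>t. (norm (?D t))\<^sup>2 + ((norm (E t))\<^sup>2 + 2 * (?D t * E t)) \<partial>circle)"
    unfolding H10_nrm_def L2_nrm_sq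
    by (intro Bochner_Integration.integral_cong refl) (simp add: E_def power2_eq_square algebra_simps)
  also have "\<dots> = (H10_nrm \<eta>)\<^sup>2 + ((L2_nrm circle E)\<^sup>2 + 2 * (\<integral>t. ?D t * E t \<partial>circle))"
    using D(1) E i unfolding H10_nrm_def L2_nrm_sq Lq_2_iff by simp
  finally have "(H10_nrm \<gamma>)\<^sup>2 - (H10_nrm \<eta>)\<^sup>2 = (L2_nrm circle E)\<^sup>2 + 2 * (\<integral>t. ?D t * E t \<partial>circle)" by simp
  from that[OF E wE 1 this] show ?thesis .
qed

text \<open>By Tonelli it suffices to look at slices: over \<open>t\<close> the hypographs differ
  exactly on the half-open interval \<open>?I\<close> between the two values, which lies in the
  half-line because both are nonnegative.\<close>

lemma F_dist_sq:
  assumes \<gamma>: "\<gamma> \<in> borel_measurable circle" "\<And>t. 0 \<le> \<gamma> t"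
    and \<eta>: "\<eta> \<in> borel_measurable circle" "\<And>t. 0 \<le> \<eta> t"
    and i: "integrable circle (\<lambda>t. \<bar>\<gamma> t - \<eta> t\<bar>)"
  shows "(F_dist \<gamma> \<eta>)\<^sup>2 = (\<integral>t. \<bar>\<gamma> t - \<eta> t\<bar> \<partial>circle)"
proof -
  let ?R = "restrict_space lborel {0::real..}"
  interpret R: sigma_finite_measure ?R
    by (rule sigma_finite_measure_restrict_space) (auto intro: sigma_finite_lborel)
  have [measurable]: "\<gamma> \<in> borel_measurable circle" "\<eta> \<in> borel_measurable circle" by fact+
  have [measurable]: "(\<lambda>x. x) \<in> borel_measurable ?R"
    by (intro measurable_restrict_space1) simp
  have [measurable]: "snd \<in> borel_measurable (circle \<Otimes>\<^sub>M ?R)"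
    using measurable_compose[OF measurable_snd, of "\<lambda>x. x" ?R borel circle] by simp
  have Fm: "F \<zeta> \<in> borel_measurable half_cylinder" if [measurable]: "\<zeta> \<in> borel_measurable circle" for \<zeta>
  proof -
    have "F \<zeta> = (\<lambda>p. if 0 \<le> snd p \<and> snd p \<le> \<zeta> (fst p) then 1 else 0)"
      by (auto simp: F_def hyp_def fun_eq_iff)
    then show ?thesis unfolding half_cylinder_def by simp
  qed
  have m: "(\<lambda>p. (norm (F \<gamma> p - F \<eta> p))\<^sup>2) \<in> borel_measurable half_cylinder"
    using Fm[OF \<gamma>(1)] Fm[OF \<eta>(1)] by measurable
  have "(\<integral>p. (norm (F \<gamma> p - F \<eta> p))\<^sup>2 \<partial>half_cylinder)
      = enn2real (\<integral>\<^sup>+p. ennreal ((norm (F \<gamma> p - F \<eta> p))\<^sup>2) \<partial>half_cylinder)"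
    by (rule integral_eq_nn_integral[OF m]) simp
  also have "(\<integral>\<^sup>+p. ennreal ((norm (F \<gamma> p - F \<eta> p))\<^sup>2) \<partial>half_cylinder)
      = (\<integral>\<^sup>+t. \<integral>\<^sup>+x. ennreal ((norm (F \<gamma> (t, x) - F \<eta> (t, x)))\<^sup>2) \<partial>?R \<partial>circle)"
    using m unfolding half_cylinder_def by (intro R.nn_integral_fst[symmetric]) simp
  also have "\<dots> = (\<integral>\<^sup>+t. ennreal \<bar>\<gamma> t - \<eta> t\<bar> \<partial>circle)"
  proof (rule nn_integral_cong)
    fix t
    let ?I = "{min (\<gamma> t) (\<eta> t)<..max (\<gamma> t) (\<eta> t)}"
    have "(\<integral>\<^sup>+x. ennreal ((norm (F \<gamma> (t, x) - F \<eta> (t, x)))\<^sup>2) \<partial>?R)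
        = (\<integral>\<^sup>+x. ennreal ((norm (F \<gamma> (t, x) - F \<eta> (t, x)))\<^sup>2) * indicator {0..} x \<partial>lborel)"
      by (rule nn_integral_restrict_space) simp
    also have "\<dots> = (\<integral>\<^sup>+x. indicator ?I x \<partial>lborel)"
    proof (rule nn_integral_cong)
      fix x :: real
      have *: "(norm (F \<gamma> (t, x) - F \<eta> (t, x)))\<^sup>2 * indicator {0..} x = (indicator ?I x :: real)"
        using \<gamma>(2)[of t] \<eta>(2)[of t]
        by (cases "0 \<le> x"; cases "x \<le> \<gamma> t"; cases "x \<le> \<eta> t") (auto simp: F_def hyp_def indicator_def min_def max_def)
      have "ennreal a * indicator {0..} x = ennreal (a * indicator {0..} x)" for a
        by (simp split: split_indicator)
      then show "ennreal ((norm (F \<gamma> (t, x) - F \<eta> (t, x)))\<^sup>2) * indicator {0..} x = indicator ?I x"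
        by (simp only: * ennreal_indicator)
    qed
    also have "\<dots> = ennreal \<bar>\<gamma> t - \<eta> t\<bar>"
      by (cases "\<gamma> t \<le> \<eta> t") simp_all
    finally show "(\<integral>\<^sup>+x. ennreal ((norm (F \<gamma> (t, x) - F \<eta> (t, x)))\<^sup>2) \<partial>?R) = ennreal \<bar>\<gamma> t - \<eta> t\<bar>" .
  qed
  also have "\<dots> = ennreal (\<integral>t. \<bar>\<gamma> t - \<eta> t\<bar> \<partial>circle)"
    by (rule nn_integral_eq_integral[OF i]) simp
  finally show ?thesis
    by (simp add: F_dist_def L2_nrm_sq)
qed

section \<open>The variational inequality\<close>

text \<open>Given by its coefficients, so that derivatives act on them as multipliers.\<close>

definition fejer_mean :: "(real \<Rightarrow> complex) \<Rightarrow> nat \<Rightarrow> real \<Rightarrow> complex" where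
  "fejer_mean f N = tpoly {- int N..int N} (\<lambda>k. of_real (1 - \<bar>k\<bar> / (real N + 1)) * fc f k)"

lemma powr_le_one_plus_sq:
  fixes x s :: real
  assumes "0 < x" "0 \<le> s" shows "x powr s \<le> (1 + x\<^sup>2) powr (s / 2)"
proof -
  have "x powr s = (x powr 2) powr (s / 2)" by (simp add: powr_powr del: powr_numeral)
  also have "\<dots> = (x\<^sup>2) powr (s / 2)" using assms by simp
  also have "\<dots> \<le> (1 + x\<^sup>2) powr (s / 2)" using assms by (intro powr_mono2) auto
  finally show ?thesis .
qed

text \<open>The left-hand side is the modulus of the multiplier taking a function to the derivative
  of its Fejer error. Inside the band use \<open>\<bar>k\<bar> \<le> N + 1\<close> and
  \<open>s \<le> 2\<close>, outside it \<open>\<bar>k\<bar> \<ge> N + 1\<close> and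
  \<open>1 < s\<close>.\<close>

lemma fejer_error_symbol_le:
  assumes s: "1 < s" "s \<le> 2"
  shows "\<bar>real_of_int k\<bar> * (if \<bar>k\<bar> \<le> int N then \<bar>real_of_int k\<bar> / (real N + 1) else 1)
    \<le> (real N + 1) powr (1 - s) * (1 + (real_of_int k)\<^sup>2) powr (s / 2)"
proof (cases "k = 0")
  case False
  define x m where "x = \<bar>real_of_int k\<bar>" and "m = real N + 1"
  have x: "0 < x" and m: "0 < m" using False by (auto simp: x_def m_def)
  have "x * (if \<bar>k\<bar> \<le> int N then x / m else 1) \<le> m powr (1 - s) * x powr s"
  proof (cases "\<bar>k\<bar> \<le> int N")
    case True
    then have "x \<le> m" unfolding x_def m_def by linarith
    then have "x powr (2 - s) \<le> m powr (2 - s)" using x s by (intro powr_mono2) auto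
    then have "x powr (2 - s) * x powr s / m \<le> m powr (2 - s) * x powr s / m"
      using m by (intro divide_right_mono mult_right_mono) auto
    moreover have "x powr (2 - s) * x powr s = x * x" using x by (simp add: powr_add[symmetric] power2_eq_square)
    moreover have "m powr (2 - s) = m powr (1 - s) * m" using m powr_add[of m "1 - s" 1] by simp
    ultimately show ?thesis using True m by simp
  next
    case False
    then have "m \<le> x" unfolding x_def m_def by linarith
    then have "x powr (1 - s) \<le> m powr (1 - s)" using m s by (intro powr_mono2') auto
    then have "x powr (1 - s) * x powr s \<le> m powr (1 - s) * x powr s"
      by (intro mult_right_mono) auto
    moreover have "x powr (1 - s) * x powr s = x" using x by (simp add: powr_add[symmetric])
    ultimately show ?thesis using False by simp
  qed
  also have "\<dots> \<le> m powr (1 - s) * (1 + x\<^sup>2) powr (s / 2)"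
    using powr_le_one_plus_sq[OF x, of s] s by (intro mult_left_mono) auto
  finally show ?thesis unfolding x_def m_def by simp
qed simp

lemma pairing_fejer_mean_bound:
  fixes \<eta> D E h :: "real \<Rightarrow> real"
  assumes s: "1 < s" "s \<le> 2"
    and D: "D \<in> Lq circle 2" "has_weak_deriv \<eta> D"
    and g: "g \<in> Lq circle 2"
      "\<And>k. fc g k = of_real ((1 + (of_int k)\<^sup>2) powr (s / 2)) * fc (\<lambda>t. complex_of_real (\<eta> t)) k"
    and h: "continuous_on UNIV h" "E \<in> Lq circle 2" "has_weak_deriv h E"
    and bd: "\<And>t. norm (vderiv (vderiv (fejer_mean (\<lambda>t. complex_of_real (\<eta> t)) N)) t) \<le> B"
  shows "\<bar>\<integral>t. D t * E t \<partial>circle\<bar>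
    \<le> B * (\<integral>t. \<bar>h t\<bar> \<partial>circle) + (real N + 1) powr (1 - s) * L2_nrm circle g * L2_nrm circle E"
proof -
  let ?\<eta> = "\<lambda>t. complex_of_real (\<eta> t)" and ?D = "\<lambda>t. complex_of_real (D t)"
    and ?E = "\<lambda>t. complex_of_real (E t)" and ?h = "\<lambda>t. complex_of_real (h t)"
  define q where "q = vderiv (fejer_mean ?\<eta> N)"
  have q: "q = tpoly {- int N..int N} (\<lambda>k. \<i> * of_int k * (of_real (1 - \<bar>k\<bar> / (real N + 1)) * fc ?\<eta> k))"
    unfolding q_def fejer_mean_def vderiv_tpoly ..
  have qt: "q \<in> trig_polys" unfolding q by blast
  have q2: "q \<in> Lq circle 2" by (rule trig_polys_Lq_2[OF qt])
  have D2: "?D \<in> Lq circle 2" by (rule of_real_Lq_2[OF D(1)])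
  have E2: "?E \<in> Lq circle 2" by (rule of_real_Lq_2[OF h(2)])
  have Dq: "(\<lambda>t. ?D t - q t) \<in> Lq circle 2" by (rule Lq_2_diff[OF D2 q2])
  have fcq: "fc q k = (if k \<in> {- int N..int N} then \<i> * of_int k * (of_real (1 - \<bar>k\<bar> / (real N + 1)) * fc ?\<eta> k) else 0)" for k
    unfolding q by (simp add: fc_tpoly)
  have "norm (fc (\<lambda>t. ?D t - q t) k) \<le> (real N + 1) powr (1 - s) * norm (fc g k)" for k
  proof -
    \<comment> \<open>Inside the band the Fejer weight leaves the fraction
      \<open>\<bar>k\<bar> / (N + 1)\<close>; outside it \<open>q\<close> has no frequencies and the
      full coefficient remains.\<close>
    have "fc (\<lambda>t. ?D t - q t) k
        = \<i> * of_int k * of_real (if \<bar>k\<bar> \<le> int N then \<bar>real_of_int k\<bar> / (real N + 1) else 1) * fc ?\<eta> k"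
      unfolding fc_diff[OF D2 q2] fc_weak_deriv[OF D(2)] fcq by (auto simp: algebra_simps)
    then have "norm (fc (\<lambda>t. ?D t - q t) k)
        = \<bar>real_of_int k\<bar> * (if \<bar>k\<bar> \<le> int N then \<bar>real_of_int k\<bar> / (real N + 1) else 1) * norm (fc ?\<eta> k)"
      by (simp add: norm_mult norm_divide)
    also have "\<dots> \<le> (real N + 1) powr (1 - s) * (1 + (real_of_int k)\<^sup>2) powr (s / 2) * norm (fc ?\<eta> k)"
      by (intro mult_right_mono fejer_error_symbol_le s) simp
    also have "\<dots> = (real N + 1) powr (1 - s) * norm (fc g k)"
      unfolding g(2) by (simp add: norm_mult)
    finally show ?thesis .
  qed
  then have 1: "norm (\<integral>t. (?D t - q t) * ?E t \<partial>circle) \<le> (real N + 1) powr (1 - s) * L2_nrm circle g * L2_nrm circle E"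
    by (intro L2_pairing_le Dq g(1) h(2)) auto
  \<comment> \<open>Being a trigonometric polynomial, \<open>q\<close> is a test function, so the
    derivative moves from \<open>h\<close> to \<open>q\<close>; then only the supremum of
    \<open>vderiv q\<close> and the integral of \<open>\<bar>h\<bar>\<close> matter.\<close>
  have "(\<integral>t. q t * ?E t \<partial>circle) = dist_of ?E q" by (simp add: dist_of_def mult.commute)
  also have "\<dots> = - dist_of ?h (vderiv q)"
    using h(3) trig_polys_test[OF qt] unfolding has_weak_deriv_def by simp
  finally have "norm (\<integral>t. q t * ?E t \<partial>circle) = norm (\<integral>t. ?h t * vderiv q t \<partial>circle)"
    by (simp add: dist_of_def)
  also have "\<dots> \<le> (\<integral>t. norm (?h t * vderiv q t) \<partial>circle)" by (rule integral_norm_bound)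
  also have "\<dots> \<le> (\<integral>t. B * \<bar>h t\<bar> \<partial>circle)"
  proof (rule integral_mono)
    have h2: "?h \<in> Lq circle 2" by (rule of_real_Lq_2[OF continuous_Lq_2[OF h(1)]])
    have "vderiv q \<in> Lq circle 2"
      unfolding q vderiv_tpoly by (intro trig_polys_Lq_2 tpoly_in_trig_polys) simp
    from integrable_norm[OF Lq_2_mult_integrable[OF h2 this]]
    show "integrable circle (\<lambda>t. norm (?h t * vderiv q t))" .
    show "integrable circle (\<lambda>t. B * \<bar>h t\<bar>)"
      using integrable_norm[OF circle.Lq_2_integrable[OF h2]] by simp
    show "norm (?h t * vderiv q t) \<le> B * \<bar>h t\<bar>" for t
      using mult_right_mono[OF bd[of t], of "\<bar>h t\<bar>"] unfolding q_def norm_mult by (simp add: mult.commute)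
  qed
  also have "\<dots> = B * (\<integral>t. \<bar>h t\<bar> \<partial>circle)" by simp
  finally have 2: "norm (\<integral>t. q t * ?E t \<partial>circle) \<le> B * (\<integral>t. \<bar>h t\<bar> \<partial>circle)" .
  have "complex_of_real (\<integral>t. D t * E t \<partial>circle) = (\<integral>t. complex_of_real (D t * E t) \<partial>circle)"
    by (rule integral_complex_of_real[symmetric])
  also have "\<dots> = (\<integral>t. q t * ?E t + (?D t - q t) * ?E t \<partial>circle)"
    by (simp add: algebra_simps)
  also have "\<dots> = (\<integral>t. q t * ?E t \<partial>circle) + (\<integral>t. (?D t - q t) * ?E t \<partial>circle)"
    by (intro Bochner_Integration.integral_add Lq_2_mult_integrable q2 E2 Dq)
  finally have "norm (complex_of_real (\<integral>t. D t * E t \<partial>circle))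
      \<le> B * (\<integral>t. \<bar>h t\<bar> \<partial>circle) + (real N + 1) powr (1 - s) * L2_nrm circle g * L2_nrm circle E"
    using norm_triangle_ineq[of "\<integral>t. q t * ?E t \<partial>circle" "\<integral>t. (?D t - q t) * ?E t \<partial>circle"] 1 2
    by simp
  then show ?thesis by simp
qed

section \<open>Growth of the second derivative of the Fejer means\<close>

lemma vderiv2_fejer_mean:
  "vderiv (vderiv (fejer_mean f N))
    = tpoly {- int N..int N} (\<lambda>k. of_real (- (of_int k)\<^sup>2 * (1 - \<bar>k\<bar> / (real N + 1))) * fc f k)"
  unfolding fejer_mean_def vderiv_tpoly
  by (rule arg_cong[where f = "tpoly _"]) (simp add: fun_eq_iff power2_eq_square algebra_simps)

text \<open>In the band \<open>k\<^sup>2 \<le> m powr (2 - s) * (1 + k\<^sup>2) powr (s / 2)\<close>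
  with \<open>m = N + 1\<close>. Summing the coefficients of \<open>g\<close> by Cauchy-Schwarz and
  Bessel costs a further \<open>sqrt m\<close>.\<close>

lemma vderiv2_fejer_mean_L2_bound:
  assumes s: "1 < s" "s \<le> 2" and g: "g \<in> Lq circle 2"
    and fg: "\<And>k. fc g k = of_real ((1 + (of_int k)\<^sup>2) powr (s / 2)) * fc f k"
  shows "norm (vderiv (vderiv (fejer_mean f N)) t) \<le> L2_nrm circle g * (real N + 1) powr (5 / 2 - s)"
proof -
  let ?I = "{- int N..int N}"
  define m where "m = real N + 1"
  have m: "0 < m" by (simp add: m_def)
  have "norm (vderiv (vderiv (fejer_mean f N)) t) \<le> (\<Sum>k\<in>?I. m powr (2 - s) * norm (fc g k))"
    unfolding vderiv2_fejer_mean
  proof (intro order_trans[OF tpoly_norm_le] sum_mono)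
    fix k assume k: "k \<in> ?I"
    then have km: "\<bar>real_of_int k\<bar> \<le> m" unfolding m_def by auto
    then have w: "\<bar>1 - \<bar>real_of_int k\<bar> / m\<bar> \<le> 1" using m by (auto simp: abs_le_iff field_simps)
    have "(real_of_int k)\<^sup>2 \<le> m powr (2 - s) * (1 + (real_of_int k)\<^sup>2) powr (s / 2)"
    proof (cases "k = 0")
      case False
      define x where "x = \<bar>real_of_int k\<bar>"
      have x: "0 < x" using False by (simp add: x_def)
      have "x\<^sup>2 = x powr (2 - s) * x powr s" using x by (simp add: powr_add[symmetric])
      also have "\<dots> \<le> m powr (2 - s) * (1 + x\<^sup>2) powr (s / 2)"
        using x s km powr_le_one_plus_sq[OF x, of s] unfolding x_def [symmetric]
        by (intro mult_mono powr_mono2) auto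
      finally show ?thesis by (simp add: x_def)
    qed (use m in simp)
    then have "(real_of_int k)\<^sup>2 * \<bar>1 - \<bar>real_of_int k\<bar> / m\<bar> * norm (fc f k)
        \<le> m powr (2 - s) * (1 + (real_of_int k)\<^sup>2) powr (s / 2) * 1 * norm (fc f k)"
      using w by (intro mult_right_mono mult_mono) auto
    then show "norm (of_real (- (of_int k)\<^sup>2 * (1 - \<bar>k\<bar> / (real N + 1))) * fc f k) \<le> m powr (2 - s) * norm (fc g k)"
      unfolding fg m_def [symmetric] norm_mult norm_of_real by (simp add: abs_mult mult.assoc)
  qed
  also have "\<dots> = m powr (2 - s) * (\<Sum>k\<in>?I. norm (fc g k) * 1)" by (simp add: sum_distrib_left)
  also have "(\<Sum>k\<in>?I. norm (fc g k) * 1) \<le> L2_nrm circle g * sqrt m"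
  proof (rule power2_le_imp_le)
    have "(\<Sum>k\<in>?I. norm (fc g k) * 1)\<^sup>2 \<le> (\<Sum>k\<in>?I. (norm (fc g k))\<^sup>2) * (\<Sum>k\<in>?I. 1\<^sup>2)"
      by (rule Cauchy_Schwarz_ineq_sum)
    \<comment> \<open>There are \<open>2 * N + 1 \<le> 2 * m\<close> frequencies; the
      \<open>2 * pi\<close> in Bessel's inequality absorbs the factor 2.\<close>
    also have "\<dots> \<le> (\<Sum>k\<in>?I. (norm (fc g k))\<^sup>2) * (2 * m)"
      unfolding m_def by (intro mult_left_mono sum_nonneg) auto
    also have "\<dots> = (2 * (\<Sum>k\<in>?I. (norm (fc g k))\<^sup>2)) * m" by simp
    also have "\<dots> \<le> (2 * pi * (\<Sum>k\<in>?I. (norm (fc g k))\<^sup>2)) * m"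
      using m pi_gt3 by (intro mult_right_mono sum_nonneg) auto
    also have "\<dots> \<le> (L2_nrm circle g)\<^sup>2 * m"
      using m by (intro mult_right_mono Bessel g) auto
    also have "\<dots> = (L2_nrm circle g * sqrt m)\<^sup>2" using m by (simp add: power_mult_distrib)
    finally show "(\<Sum>k\<in>?I. norm (fc g k) * 1)\<^sup>2 \<le> (L2_nrm circle g * sqrt m)\<^sup>2" .
  qed (use m in \<open>simp add: L2_nrm_nonneg\<close>)
  finally have "norm (vderiv (vderiv (fejer_mean f N)) t) \<le> m powr (2 - s) * (L2_nrm circle g * sqrt m)"
    by (simp add: mult_left_mono)
  also have "\<dots> = L2_nrm circle g * m powr (5 / 2 - s)"
    using m by (simp add: powr_half_sqrt[symmetric] powr_add[symmetric] mult.left_commute)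
  finally show ?thesis by (simp add: m_def)
qed

text \<open>Essential bounds allow the Fejer multiplier estimate in place of summing coefficients,
  which saves the factor \<open>sqrt m\<close>. The splitting
  \<open>- k\<^sup>2 = 1 - (1 + k\<^sup>2)\<close> gives \<open>f\<close> the multiplier 1 and
  \<open>g\<close> the multiplier \<open>(1 + k\<^sup>2) powr (1 - s / 2)\<close>, both monotone in
  \<open>\<bar>k\<bar>\<close>.\<close>

lemma vderiv2_fejer_mean_sup_bound:
  assumes s: "1 < s" "s \<le> 2"
    and f: "f \<in> borel_measurable circle" "AE t in circle. norm (f t) \<le> A" "0 \<le> A"
    and g: "g \<in> borel_measurable circle" "AE t in circle. norm (g t) \<le> B" "0 \<le> B"
    and fg: "\<And>k. fc g k = of_real ((1 + (of_int k)\<^sup>2) powr (s / 2)) * fc f k"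
  obtains C where "0 \<le> C"
    "\<And>N t. norm (vderiv (vderiv (fejer_mean f N)) t) \<le> C * (real N + 1) powr (2 - s)"
proof -
  define \<sigma> where "\<sigma> = 1 - s / 2"
  have \<sigma>: "0 \<le> \<sigma>" "\<sigma> < 1 / 2" "2 * \<sigma> = 2 - s" using s by (auto simp: \<sigma>_def)
  define u where "u n = (1 + (real n)\<^sup>2) powr \<sigma>" for n :: nat
  obtain C0 where C0: "0 \<le> C0" and C0_bound:
    "\<And>N. (\<Sum>n\<le>N. (real n + 1) * \<bar>u n - 2 * u (n + 1) + u (n + 2)\<bar>) + 3 * u (N + 2) \<le> C0 * (real N + 1) powr (2 * \<sigma>)"
    unfolding u_def by (rule second_difference_sum_le[OF \<sigma>(1,2)]) blast
  have mono_u: "mono u" unfolding u_def using \<sigma>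
    by (intro monoI powr_mono2 add_left_mono power_mono) auto
  have "norm (vderiv (vderiv (fejer_mean f N)) t) \<le> (B * C0 + 3 * A) * (real N + 1) powr (2 - s)" for N t
  proof -
    let ?I = "{- int N..int N}"
    let ?P = "tpoly ?I (\<lambda>k. of_real (u (nat \<bar>k\<bar>) * (1 - \<bar>k\<bar> / (real N + 1))) * fc g k)"
    let ?Q = "tpoly ?I (\<lambda>k. of_real ((\<lambda>_. 1) (nat \<bar>k\<bar>) * (1 - \<bar>k\<bar> / (real N + 1))) * fc f k)"
    have uk: "u (nat \<bar>k\<bar>) * (1 + (of_int k)\<^sup>2) powr (s / 2) = 1 + (of_int k)\<^sup>2" for k :: int
    proof -
      have p: "0 < 1 + (real_of_int k)\<^sup>2" by (smt (verit) zero_le_power2)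
      have "real (nat \<bar>k\<bar>) = \<bar>real_of_int k\<bar>" by simp
      then have "u (nat \<bar>k\<bar>) * (1 + (of_int k)\<^sup>2) powr (s / 2) = (1 + (real_of_int k)\<^sup>2) powr 1"
        unfolding u_def \<sigma>_def by (simp only: power2_abs powr_add[symmetric]) simp
      then show ?thesis using p by simp
    qed
    \<comment> \<open>\<open>?Q\<close> is the Fejer mean \<open>\<sigma>\<close> itself and \<open>?P = \<sigma> - \<sigma>''\<close>.\<close>
    have "vderiv (vderiv (fejer_mean f N)) t = ?Q t - ?P t"
      unfolding vderiv2_fejer_mean tpoly_def sum_subtractf[symmetric]
    proof (intro sum.cong refl)
      fix k :: int
      let ?w = "1 - \<bar>k\<bar> / (real N + 1)"
      have "of_real (u (nat \<bar>k\<bar>) * ?w) * fc g k = of_real ((u (nat \<bar>k\<bar>) * (1 + (of_int k)\<^sup>2) powr (s / 2)) * ?w) * fc f k"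
        unfolding fg by simp
      also have "\<dots> = of_real ((1 + (of_int k)\<^sup>2) * ?w) * fc f k" unfolding uk ..
      finally have e: "of_real (u (nat \<bar>k\<bar>) * ?w) * fc g k = of_real ((1 + (of_int k)\<^sup>2) * ?w) * fc f k" .
      show "of_real (- (of_int k)\<^sup>2 * ?w) * fc f k * chr k t
        = of_real (1 * ?w) * fc f k * chr k t - of_real (u (nat \<bar>k\<bar>) * ?w) * fc g k * chr k t"
        unfolding e by (simp add: algebra_simps add_divide_distrib)
    qed
    then have "norm (vderiv (vderiv (fejer_mean f N)) t) \<le> norm (?Q t) + norm (?P t)"
      by (simp add: norm_triangle_ineq4)
    also have "norm (?Q t) \<le> A * ((\<Sum>n\<le>N. (real n + 1) * \<bar>1 - 2 * 1 + 1\<bar>) + 3 * 1)"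
      by (rule fejer_multiplier_bound[OF f, where u = "\<lambda>_. 1"]) (auto intro: monoI)
    also have "\<dots> = 3 * A * 1" by simp
    also have "\<dots> \<le> 3 * A * (real N + 1) powr (2 - s)"
      using f(3) s by (intro mult_left_mono ge_one_powr_ge_zero) auto
    also have "norm (?P t) \<le> B * ((\<Sum>n\<le>N. (real n + 1) * \<bar>u n - 2 * u (n + 1) + u (n + 2)\<bar>) + 3 * u (N + 2))"
      by (rule fejer_multiplier_bound[OF g mono_u]) (simp add: u_def)
    also have "\<dots> \<le> B * (C0 * (real N + 1) powr (2 - s))"
      using C0_bound[of N] unfolding \<sigma>(3) by (intro mult_left_mono g(3))
    finally show ?thesis by (simp add: algebra_simps)
  qed
  then show ?thesis
    by (intro that[of "B * C0 + 3 * A"]) (use C0 f(3) g(3) in simp_all)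
qed

section \<open>Absorption of the pairing and conclusion\<close>

text \<open>For \<open>N + 1\<close> about \<open>\<delta> powr (- \<alpha>)\<close>, Young's
  inequality turns the second term into order \<open>\<delta> powr (\<alpha> * (2 * s - 2))\<close>,
  while the first has order \<open>\<delta> powr (2 - \<alpha> * \<rho>)\<close>. The two upper
  bounds on \<open>\<beta>\<close> let \<open>\<delta> powr \<beta>\<close> dominate both for
  \<open>\<delta> < 1\<close>.\<close>

lemma absorb_pairing:
  fixes s \<rho> \<alpha> \<beta> :: real
  assumes s: "1 < s" and e: "0 < \<alpha>" "0 \<le> \<beta>" "0 \<le> \<rho>" "\<beta> \<le> \<alpha> * (2 * s - 2)" "\<beta> \<le> 2 - \<alpha> * \<rho>"
    and C: "0 \<le> C1" "0 \<le> C2" "0 \<le> C3"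
  obtains C where "0 < C"
    "\<And>P \<delta> b. 0 \<le> \<delta> \<Longrightarrow> 0 \<le> b \<Longrightarrow> \<bar>P\<bar> \<le> C3 * b \<Longrightarrow>
      (\<And>N. \<bar>P\<bar> \<le> C1 * (real N + 1) powr \<rho> * \<delta>\<^sup>2 + C2 * (real N + 1) powr (1 - s) * b) \<Longrightarrow>
      2 * \<bar>P\<bar> \<le> b\<^sup>2 / 2 + C * \<delta> powr \<beta>"
proof -
  \<comment> \<open>One constant for all regimes: the first two summands serve
    \<open>\<delta> < 1\<close>, the third \<open>\<delta> \<ge> 1\<close>, and the 1 ensures
    positivity.\<close>
  define C where "C = 2 * C2\<^sup>2 + 2 * C1 * 2 powr \<rho> + 2 * C3\<^sup>2 + 1"
  have C_pos: "0 < C" using C by (auto simp: C_def intro!: add_nonneg_pos)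
  have young: "2 * (a * b) \<le> b\<^sup>2 / 2 + 2 * a\<^sup>2" for a b :: real
    using zero_le_power2[of "b / 2 - a"] by (simp add: power2_eq_square algebra_simps)
  show ?thesis
  proof (rule that[OF C_pos])
    fix P \<delta> b :: real
    assume \<delta>: "0 \<le> \<delta>" and b: "0 \<le> b" and triv: "\<bar>P\<bar> \<le> C3 * b"
      and bd: "\<And>N. \<bar>P\<bar> \<le> C1 * (real N + 1) powr \<rho> * \<delta>\<^sup>2 + C2 * (real N + 1) powr (1 - s) * b"
    consider "\<delta> = 0" | "0 < \<delta>" "\<delta> < 1" | "1 \<le> \<delta>" using \<delta> by linarith
    then show "2 * \<bar>P\<bar> \<le> b\<^sup>2 / 2 + C * \<delta> powr \<beta>"
    proof cases
      case 1
      \<comment> \<open>Here \<open>\<delta> powr \<beta> = 0\<close> even if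
        \<open>\<beta> = 0\<close>, so the error term gives nothing; letting \<open>N\<close> tend
        to infinity forces \<open>P = 0\<close>.\<close>
      have "filterlim (\<lambda>N. real N + 1) at_top sequentially"
        by (rule filterlim_at_top_mono[OF filterlim_real_sequentially]) simp
      then have "(\<lambda>N. (real N + 1) powr (1 - s)) \<longlonglongrightarrow> 0"
        using s by (intro tendsto_neg_powr) auto
      then have "(\<lambda>N. C2 * (real N + 1) powr (1 - s) * b) \<longlonglongrightarrow> C2 * 0 * b"
        by (intro tendsto_intros)
      moreover have "\<bar>P\<bar> \<le> C2 * (real N + 1) powr (1 - s) * b" for N using bd[of N] 1 by simp
      ultimately have "\<bar>P\<bar> \<le> C2 * 0 * b" by (intro LIMSEQ_le_const) auto
      then show ?thesis using 1 by simp
    next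
      case 3
      have "2 * \<bar>P\<bar> \<le> b\<^sup>2 / 2 + 2 * C3\<^sup>2" using young[of C3 b] triv by linarith
      also have "2 * C3\<^sup>2 \<le> C * 1" using C by (simp add: C_def)
      also have "\<dots> \<le> C * \<delta> powr \<beta>"
        using C_pos e 3 by (intro mult_left_mono ge_one_powr_ge_zero) auto
      finally show ?thesis by simp
    next
      case 2
      \<comment> \<open>Apply the bound with \<open>N + 1\<close> comparable to \<open>\<delta> powr (- \<alpha>)\<close>.\<close>
      define x where "x = \<delta> powr (- \<alpha>)"
      have x1: "1 \<le> x"
        using 2 e powr_mono2'[of "- \<alpha>" \<delta> 1] by (simp add: x_def)
      define N where "N = nat \<lfloor>x\<rfloor>"
      \<comment> \<open>Rounding costs at most a factor 2 because \<open>1 \<le> x\<close>; this is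
        the source of \<open>2 powr \<rho>\<close> in \<open>C\<close>.\<close>
      have N: "x \<le> real N + 1" "real N + 1 \<le> 2 * x"
        using x1 unfolding N_def by linarith+
      define m where "m = real N + 1"
      have m0: "0 < m" "1 \<le> m" by (auto simp: m_def)
      have small: "\<delta> powr a \<le> \<delta> powr \<beta>" if "\<beta> \<le> a" for a
        using 2 that by (intro powr_mono') auto
      have "(m powr (1 - s))\<^sup>2 = m powr (2 - 2 * s)"
        by (simp add: power2_eq_square powr_add[symmetric])
      also have "\<dots> \<le> x powr (2 - 2 * s)"
        using s x1 N by (intro powr_mono2') (auto simp: m_def)
      also have "\<dots> = \<delta> powr (\<alpha> * (2 * s - 2))"
        by (simp add: x_def powr_powr algebra_simps)
      also have "\<dots> \<le> \<delta> powr \<beta>" by (rule small[OF e(4)])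
      finally have h1: "(m powr (1 - s))\<^sup>2 \<le> \<delta> powr \<beta>" .
      have "m powr \<rho> * \<delta>\<^sup>2 \<le> (2 * x) powr \<rho> * \<delta>\<^sup>2"
        using e N m0 by (intro mult_right_mono powr_mono2) (auto simp: m_def)
      also have "\<dots> = 2 powr \<rho> * (\<delta> powr (- \<alpha> * \<rho>) * \<delta> powr 2)"
        using 2 x1 by (simp add: powr_mult x_def powr_powr)
      also have "\<delta> powr (- \<alpha> * \<rho>) * \<delta> powr 2 = \<delta> powr (2 - \<alpha> * \<rho>)"
        unfolding powr_add[symmetric] by simp
      also have "2 powr \<rho> * \<dots> \<le> 2 powr \<rho> * \<delta> powr \<beta>"
        by (intro mult_left_mono small e) auto
      finally have h2: "m powr \<rho> * \<delta>\<^sup>2 \<le> 2 powr \<rho> * \<delta> powr \<beta>" .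
      have "2 * \<bar>P\<bar> \<le> 2 * C1 * (m powr \<rho> * \<delta>\<^sup>2) + 2 * ((C2 * m powr (1 - s)) * b)"
        using bd[of N] by (simp add: m_def)
      also have "\<dots> \<le> 2 * C1 * (2 powr \<rho> * \<delta> powr \<beta>) + (b\<^sup>2 / 2 + 2 * (C2 * m powr (1 - s))\<^sup>2)"
        using C h2 young by (intro add_mono mult_left_mono) auto
      also have "\<dots> = b\<^sup>2 / 2 + (2 * C1 * 2 powr \<rho> * \<delta> powr \<beta> + 2 * C2\<^sup>2 * (m powr (1 - s))\<^sup>2)"
        by (simp add: power_mult_distrib)
      also have "\<dots> \<le> b\<^sup>2 / 2 + (2 * C1 * 2 powr \<rho> * \<delta> powr \<beta> + 2 * C2\<^sup>2 * \<delta> powr \<beta>)"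
        using C h1 by (intro add_left_mono mult_left_mono) auto
      also have "\<dots> = b\<^sup>2 / 2 + (2 * C1 * 2 powr \<rho> + 2 * C2\<^sup>2) * \<delta> powr \<beta>"
        by (simp add: algebra_simps)
      also have "\<dots> \<le> b\<^sup>2 / 2 + C * \<delta> powr \<beta>"
        unfolding C_def by (intro add_left_mono mult_right_mono) auto
      finally show ?thesis .
    qed
  qed
qed

text \<open>The common core of both cases, which differ in the growth rate \<open>\<rho>\<close> of
  the second derivative and in the exponents \<open>\<alpha>\<close> and
  \<open>\<beta>\<close>.\<close>

lemma variational_bound:
  assumes s: "1 < s" "s \<le> 2" and \<gamma>d: "\<gamma>d \<in> H1_plus"
    and g: "g \<in> Lq circle 2"
      "\<And>k. fc g k = of_real ((1 + (of_int k)\<^sup>2) powr (s / 2)) * fc (\<lambda>t. complex_of_real (\<gamma>d t)) k"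
    and C1: "0 \<le> C1"
      "\<And>N t. norm (vderiv (vderiv (fejer_mean (\<lambda>t. complex_of_real (\<gamma>d t)) N)) t) \<le> C1 * (real N + 1) powr \<rho>"
    and e: "0 < \<alpha>" "0 \<le> \<beta>" "0 \<le> \<rho>" "\<beta> \<le> \<alpha> * (2 * s - 2)" "\<beta> \<le> 2 - \<alpha> * \<rho>"
  obtains C where "0 < C" "\<And>\<gamma>. \<gamma> \<in> H1_plus \<Longrightarrow>
    1 / 2 * (H10_nrm (\<lambda>t. \<gamma> t - \<gamma>d t))\<^sup>2 \<le> (H10_nrm \<gamma>)\<^sup>2 - (H10_nrm \<gamma>d)\<^sup>2 + C * F_dist \<gamma> \<gamma>d powr \<beta>"
proof -
  let ?D = "weak_deriv \<gamma>d"
  have \<gamma>d1: "\<gamma>d \<in> H1" "\<And>t. 0 \<le> \<gamma>d t" "continuous_on UNIV \<gamma>d" using \<gamma>d by (auto simp: H1_plus_def H1_def)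
  note D = weak_deriv_spec[OF \<gamma>d1(1)]
  obtain C where C: "0 < C" and absorb:
    "\<And>P \<delta> b. 0 \<le> \<delta> \<Longrightarrow> 0 \<le> b \<Longrightarrow> \<bar>P\<bar> \<le> L2_nrm circle ?D * b \<Longrightarrow>
      (\<And>N. \<bar>P\<bar> \<le> C1 * (real N + 1) powr \<rho> * \<delta>\<^sup>2 + L2_nrm circle g * (real N + 1) powr (1 - s) * b) \<Longrightarrow>
      2 * \<bar>P\<bar> \<le> b\<^sup>2 / 2 + C * \<delta> powr \<beta>"
  proof (rule absorb_pairing[OF s(1) e C1(1) L2_nrm_nonneg L2_nrm_nonneg, of circle ?D circle g], goal_cases)
    case (1 C)
    show ?case by (rule 1(1)[OF 1(2,3)])
  qed
  show ?thesis
  proof (rule that[OF C])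
    fix \<gamma> assume "\<gamma> \<in> H1_plus"
    then have \<gamma>: "\<gamma> \<in> H1" "\<And>t. 0 \<le> \<gamma> t" "continuous_on UNIV \<gamma>" by (auto simp: H1_plus_def H1_def)
    let ?h = "\<lambda>t. \<gamma> t - \<gamma>d t"
    obtain E where E: "E \<in> Lq circle 2" "has_weak_deriv ?h E"
      and H: "H10_nrm ?h = L2_nrm circle E"
      and ex: "(H10_nrm \<gamma>)\<^sup>2 - (H10_nrm \<gamma>d)\<^sup>2 = (L2_nrm circle E)\<^sup>2 + 2 * (\<integral>t. ?D t * E t \<partial>circle)"
      by (rule H10_nrm_expansion[OF \<gamma>(1) \<gamma>d1(1)])
    define P where "P = (\<integral>t. ?D t * E t \<partial>circle)"
    have ch: "continuous_on UNIV ?h" by (intro continuous_intros \<gamma> \<gamma>d1)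
    have hi: "integrable circle (\<lambda>t. \<bar>?h t\<bar>)"
      using integrable_norm[OF circle.Lq_2_integrable[OF of_real_Lq_2[OF continuous_Lq_2[OF ch]]]]
      unfolding norm_of_real .
    have d: "(F_dist \<gamma> \<gamma>d)\<^sup>2 = (\<integral>t. \<bar>?h t\<bar> \<partial>circle)"
      by (rule F_dist_sq[OF circle_continuous[OF \<gamma>(3)] \<gamma>(2) circle_continuous[OF \<gamma>d1(3)] \<gamma>d1(2) hi])
    have d0: "0 \<le> F_dist \<gamma> \<gamma>d" by (simp add: F_dist_def L2_nrm_nonneg)
    have triv: "\<bar>P\<bar> \<le> L2_nrm circle ?D * L2_nrm circle E"
      using L2_Cauchy_Schwarz[OF of_real_Lq_2[OF D(1)] of_real_Lq_2[OF E(1)]]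
      unfolding of_real_mult[symmetric] integral_complex_of_real norm_of_real L2_nrm_of_real P_def .
    have main: "\<bar>P\<bar> \<le> C1 * (real N + 1) powr \<rho> * (F_dist \<gamma> \<gamma>d)\<^sup>2
        + L2_nrm circle g * (real N + 1) powr (1 - s) * L2_nrm circle E" for N
      using pairing_fejer_mean_bound[OF s D g ch E C1(2), of N]
      unfolding d P_def by (simp only: mult.commute[of "L2_nrm circle g"])
    have "2 * \<bar>P\<bar> \<le> (L2_nrm circle E)\<^sup>2 / 2 + C * F_dist \<gamma> \<gamma>d powr \<beta>"
      by (rule absorb[OF d0 L2_nrm_nonneg triv main])
    \<comment> \<open>With \<open>b = L2_nrm circle E\<close> the expansion reads
      \<open>b\<^sup>2 + 2 * P\<close>. Absorption spends half of \<open>b\<^sup>2\<close>; the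
      other half is the left-hand side.\<close>
    then show "1 / 2 * (H10_nrm ?h)\<^sup>2 \<le> (H10_nrm \<gamma>)\<^sup>2 - (H10_nrm \<gamma>d)\<^sup>2 + C * F_dist \<gamma> \<gamma>d powr \<beta>"
      unfolding ex H P_def[symmetric] by (simp add: abs_le_iff) 
  qed
qed

theorem theorem4p3:
  fixes \<gamma>d :: "real \<Rightarrow> real"
  assumes "\<gamma>d \<in> H1_plus"
  shows "(\<forall>(s::real) (q::real).
      1 < s \<and> s \<le> 2 \<and> 2 \<le> q \<and> dist_of (\<lambda>t. complex_of_real (\<gamma>d t)) \<in> sobolev_W s (ereal q) \<longrightarrow>
      (\<exists>c1>0. \<exists>c2>0. \<exists>c3>0. \<forall>\<gamma>\<in>H1_plus.
         c1 * (H10_nrm (\<lambda>t. \<gamma> t - \<gamma>d t))\<^sup>2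
           \<le> (H10_nrm \<gamma>)\<^sup>2 - (H10_nrm \<gamma>d)\<^sup>2
             + c2 * F_dist \<gamma> \<gamma>d powr (4 - 4 / s)
             + c3 * F_dist \<gamma> \<gamma>d powr (2 - 2 * q / (q * s - s + 1))))
    \<and>
    (\<forall>s::real.
      1 < s \<and> s \<le> 2 \<and> dist_of (\<lambda>t. complex_of_real (\<gamma>d t)) \<in> sobolev_W s \<infinity> \<longrightarrow>
      (\<exists>c1>0. \<exists>c2>0. \<forall>\<gamma>\<in>H1_plus.
         c1 * (H10_nrm (\<lambda>t. \<gamma> t - \<gamma>d t))\<^sup>2
           \<le> (H10_nrm \<gamma>)\<^sup>2 - (H10_nrm \<gamma>d)\<^sup>2
             + c2 * F_dist \<gamma> \<gamma>d powr (4 - 4 / s)))"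
proof (intro conjI allI impI; (elim conjE)?)
  fix s q :: real
  assume s: "1 < s" "s \<le> 2" and q: "2 \<le> q"
    and W: "dist_of (\<lambda>t. complex_of_real (\<gamma>d t)) \<in> sobolev_W s (ereal q)"
  let ?\<beta> = "2 - 2 * q / (q * s - s + 1)"
  obtain g where gq: "g \<in> Lq circle (ereal q)" and fg:
    "\<And>k. fc g k = of_real ((1 + (of_int k)\<^sup>2) powr (s / 2)) * fc (\<lambda>t. complex_of_real (\<gamma>d t)) k"
  proof -
    from W have "\<exists>g\<in>Lq circle (ereal q). \<forall>k. fourier_coeff (dist_of g) k
      = of_real ((1 + (of_int k)\<^sup>2) powr (s / 2)) * fourier_coeff (dist_of (\<lambda>t. complex_of_real (\<gamma>d t))) k"
      unfolding sobolev_W_def by blast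
    then show ?thesis using that unfolding fourier_coeff_dist_of by blast
  qed
  have g: "g \<in> Lq circle 2" by (rule circle.Lq_imp_Lq_2[OF gq q])
  have pos: "0 < q * s - s + 1"
  proof -
    have "0 \<le> (q - 1) * s" using s q by (intro mult_nonneg_nonneg) auto
    then show ?thesis by (simp add: algebra_simps)
  qed
  \<comment> \<open>\<open>2 - 2 / s\<close> is the exponent of the Fejer error for
    \<open>\<alpha> = 1 / s\<close>. The comparison amounts to
    \<open>q * s - s + 1 \<le> q * s\<close>, that is \<open>1 \<le> s\<close>.\<close>
  have \<beta>1: "?\<beta> \<le> 2 - 2 / s"
  proof -
    have "2 / s \<le> 2 * q / (q * s - s + 1)"
      using pos s by (simp add: divide_le_eq le_divide_eq)
    then show ?thesis by simp
  qed
  have \<beta>0: "0 \<le> ?\<beta>"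
  proof -
    have "0 \<le> (q - 1) * (s - 1)" using s q by (intro mult_nonneg_nonneg) auto
    then have "q \<le> q * s - s + 1" by (simp add: algebra_simps)
    then have "2 * q / (q * s - s + 1) \<le> 2" using pos by (simp add: divide_le_eq)
    then show ?thesis by simp
  qed
  \<comment> \<open>For \<open>\<alpha> = 1 / s\<close> the second derivative contributes the larger
    exponent, so the Fejer error decides.\<close>
  have \<beta>2: "2 - 2 / s \<le> 2 - 1 / s * (5 / 2 - s)" using s by (simp add: field_simps)
  obtain C where C: "0 < C" "\<And>\<gamma>. \<gamma> \<in> H1_plus \<Longrightarrow>
    1 / 2 * (H10_nrm (\<lambda>t. \<gamma> t - \<gamma>d t))\<^sup>2 \<le> (H10_nrm \<gamma>)\<^sup>2 - (H10_nrm \<gamma>d)\<^sup>2 + C * F_dist \<gamma> \<gamma>d powr ?\<beta>"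
  proof (rule variational_bound[OF s assms g fg L2_nrm_nonneg vderiv2_fejer_mean_L2_bound[OF s g fg], where \<alpha> = "1 / s"])
    show "?\<beta> \<le> 1 / s * (2 * s - 2)" using \<beta>1 s by (simp add: field_simps)
    show "?\<beta> \<le> 2 - 1 / s * (5 / 2 - s)" using \<beta>1 \<beta>2 by (rule order_trans)
  qed (use s \<beta>0 in auto)
  \<comment> \<open>The last error term alone suffices; the other one is nonnegative, so any
    positive coefficient will do, here 1.\<close>
  have "\<forall>\<gamma>\<in>H1_plus. 1 / 2 * (H10_nrm (\<lambda>t. \<gamma> t - \<gamma>d t))\<^sup>2
      \<le> (H10_nrm \<gamma>)\<^sup>2 - (H10_nrm \<gamma>d)\<^sup>2 + 1 * F_dist \<gamma> \<gamma>d powr (4 - 4 / s) + C * F_dist \<gamma> \<gamma>d powr ?\<beta>"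
  proof
    fix \<gamma> assume "\<gamma> \<in> H1_plus"
    from C(2)[OF this] show "1 / 2 * (H10_nrm (\<lambda>t. \<gamma> t - \<gamma>d t))\<^sup>2
      \<le> (H10_nrm \<gamma>)\<^sup>2 - (H10_nrm \<gamma>d)\<^sup>2 + 1 * F_dist \<gamma> \<gamma>d powr (4 - 4 / s) + C * F_dist \<gamma> \<gamma>d powr ?\<beta>"
      using powr_ge_zero[of "F_dist \<gamma> \<gamma>d" "4 - 4 / s"] by linarith
  qed
  moreover have "(0::real) < 1 / 2" "(0::real) < 1" by simp_all
  ultimately show "\<exists>c1>0. \<exists>c2>0. \<exists>c3>0. \<forall>\<gamma>\<in>H1_plus.
         c1 * (H10_nrm (\<lambda>t. \<gamma> t - \<gamma>d t))\<^sup>2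
           \<le> (H10_nrm \<gamma>)\<^sup>2 - (H10_nrm \<gamma>d)\<^sup>2
             + c2 * F_dist \<gamma> \<gamma>d powr (4 - 4 / s)
             + c3 * F_dist \<gamma> \<gamma>d powr (2 - 2 * q / (q * s - s + 1))"
    using C(1) by blast
next
  fix s :: real
  assume s: "1 < s" "s \<le> 2"
    and W: "dist_of (\<lambda>t. complex_of_real (\<gamma>d t)) \<in> sobolev_W s \<infinity>"
  obtain g where gq: "g \<in> Lq circle \<infinity>" and fg:
    "\<And>k. fc g k = of_real ((1 + (of_int k)\<^sup>2) powr (s / 2)) * fc (\<lambda>t. complex_of_real (\<gamma>d t)) k"
  proof -
    from W have "\<exists>g\<in>Lq circle \<infinity>. \<forall>k. fourier_coeff (dist_of g) k
      = of_real ((1 + (of_int k)\<^sup>2) powr (s / 2)) * fourier_coeff (dist_of (\<lambda>t. complex_of_real (\<gamma>d t))) k"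
      unfolding sobolev_W_def by blast
    then show ?thesis using that unfolding fourier_coeff_dist_of by blast
  qed
  obtain B0 where "AE t in circle. norm (g t) \<le> B0" using gq by (auto simp: Lq_def)
  then have gB: "AE t in circle. norm (g t) \<le> max B0 0" by eventually_elim simp
  have g: "g \<in> Lq circle 2" by (rule circle.bounded_imp_Lq_2[OF Lq_measurable[OF gq] gB])
  have cont: "continuous_on UNIV (\<lambda>t. complex_of_real (\<gamma>d t))"
    using assms by (intro continuous_on_of_real) (simp add: H1_plus_def H1_def)
  obtain A where A: "0 \<le> A" "AE t in circle. norm (complex_of_real (\<gamma>d t)) \<le> A"
    by (rule continuous_AE_bound[OF cont])
  obtain C1 where C1: "0 \<le> C1"
    "\<And>N t. norm (vderiv (vderiv (fejer_mean (\<lambda>t. complex_of_real (\<gamma>d t)) N)) t) \<le> C1 * (real N + 1) powr (2 - s)"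
    by (rule vderiv2_fejer_mean_sup_bound[OF s circle_continuous[OF cont] A(2,1) Lq_measurable[OF gq] gB max.cobounded2 fg]) blast
  obtain C where C: "0 < C" "\<And>\<gamma>. \<gamma> \<in> H1_plus \<Longrightarrow>
    1 / 2 * (H10_nrm (\<lambda>t. \<gamma> t - \<gamma>d t))\<^sup>2 \<le> (H10_nrm \<gamma>)\<^sup>2 - (H10_nrm \<gamma>d)\<^sup>2 + C * F_dist \<gamma> \<gamma>d powr (4 - 4 / s)"
  \<comment> \<open>\<open>\<alpha> = 2 / s\<close> balances the two contributions: for
    \<open>\<rho> = 2 - s\<close> both upper bounds on the exponent equal
    \<open>4 - 4 / s\<close>.\<close>
  proof (rule variational_bound[OF s assms g fg C1, where \<alpha> = "2 / s"])
    show "4 - 4 / s \<le> 2 / s * (2 * s - 2)" "4 - 4 / s \<le> 2 - 2 / s * (2 - s)" "0 \<le> 4 - 4 / s"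
      using s by (simp_all add: field_simps)
  qed (use s in auto)
  moreover have "(0::real) < 1 / 2" by simp
  ultimately show "\<exists>c1>0. \<exists>c2>0. \<forall>\<gamma>\<in>H1_plus.
         c1 * (H10_nrm (\<lambda>t. \<gamma> t - \<gamma>d t))\<^sup>2
           \<le> (H10_nrm \<gamma>)\<^sup>2 - (H10_nrm \<gamma>d)\<^sup>2
             + c2 * F_dist \<gamma> \<gamma>d powr (4 - 4 / s)"
    by blast
qed

end
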